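(* Let $\mathbb{K}\neq\mathbb{C}$ be a locally compact field, $E$ and $F$ topological $\mathbb{K}$-vector spaces, $f\colon U\to F$ a map on an open set $U\subseteq E$, $k\in\mathbb{N}_0\cup\{\infty\}$ and $\sigma\in\,]0,1]$. If $E$ is metrizable and $F$ is both Mackey complete and locally convex, then $f$ is $C^{k,\sigma}_{BGN}$ if and only if $f$ is weakly $C^{k,\sigma}$, i.e., $\lambda\circ f\colon U\to\mathbb{K}$ is $C^{k,\sigma}_{BGN}$ for each continuous linear functional $\lambda\colon F\to\mathbb{K}$.
   Context: A locally compact field is a non-discrete Hausdorff locally compact topological field, equipped with a fixed absolute value $|.|$ defining its topology (so here $\mathbb{K}$ is $\mathbb{R}$ or a totally disconnected local field). Vector spaces are Hausdorff. Locally convex over a totally disconnected field: topology defined by a family of ultrametric seminorms; over $\mathbb{R}$: usual. A sequence $(x_n)$ in $F$ is Mackey–Cauchy if there are a bounded set $B\subseteq F$ and $\mu_{n,m}\in\mathbb{K}$ with $x_n-x_m\in\mu_{n,m}B$ for all $n,m$ and $\mu_{n,m}\to0$ as $n,m\to\infty$; $F$ is Mackey complete if every Mackey–Cauchy sequence converges. (A set $B$ is bounded if for every $0$-neighbourhood $W$ there is a $0$-neighbourhood $V\subseteq\mathbb{K}$ with $VB\subseteq W$.) $C^k_{BGN}$: for $V\subseteq E$ with dense interior, $V^{[1]}=\{(x,y,t)\in V\times E\times\mathbb{K}:x+ty\in V\}$, $V^{]1[}$ its subset with $t\ne0$, $g^{]1[}(x,y,t)=(g(x+ty)-g(x))/t$;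 $g$ is $C^0_{BGN}$ if continuous, $C^1_{BGN}$ if continuous and $g^{]1[}$ extends continuously to $g^{[1]}$ on $V^{[1]}$, $C^k_{BGN}$ if $C^1_{BGN}$ and $g^{[1]}$ is $C^{k-1}_{BGN}$; $g^{[k]}=(g^{[1]})^{[k-1]}$, $g^{[0]}=g$; $C^\infty$ means $C^k$ for all $k$. Gauge: $q\colon E\to[0,\infty[$, $q(tx)=|t|q(x)$, each $\{q<r\}$ a $0$-neighbourhood. $g\colon V\to F$ is $C^{0,\sigma}$ if for each $x_0\in V$ and gauge $q$ on $F$ there are a gauge $p$ on $E$ and a neighbourhood $W$ of $x_0$ in $V$ with $q(g(y)-g(x))\le p(y-x)^\sigma$ for $x,y\in W$. $C^{k,\sigma}_{BGN}$: $C^k_{BGN}$ with $g^{[j]}$ $C^{0,\sigma}$ for all $j\le k$. *)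

theory Defs
  imports "HOL-Analysis.Analysis" "HOL-Library.Extended_Nat"
begin

definition abs_value :: "('k::field \<Rightarrow> real) \<Rightarrow> bool" where
  "abs_value a \<longleftrightarrow> (\<forall>x. 0 \<le> a x) \<and> (\<forall>x. a x = 0 \<longleftrightarrow> x = 0)
     \<and> (\<forall>x y. a (x * y) = a x * a y) \<and> (\<forall>x y. a (x + y) \<le> a x + a y)"

definition ktop :: "('k::field \<Rightarrow> real) \<Rightarrow> 'k topology" where
  "ktop a = topology (\<lambda>S. \<forall>x\<in>S. \<exists>r>0. \<forall>y. a (y - x) < r \<longrightarrow> y \<in> S)"

text \<open>Non-discrete locally compact field (Hausdorffness is automatic from the absolute value).\<close>
definition locally_compact_field :: "('k::field \<Rightarrow> real) \<Rightarrow> bool" where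
  "locally_compact_field a \<longleftrightarrow> abs_value a \<and> locally_compact_space (ktop a)
     \<and> \<not> openin (ktop a) {0}"

definition totally_disconnected_top :: "'a topology \<Rightarrow> bool" where
  "totally_disconnected_top T \<longleftrightarrow> (\<forall>S. connectedin T S \<longrightarrow> (\<exists>z. S \<subseteq> {z}))"

definition is_real_field :: "('k::field \<Rightarrow> real) \<Rightarrow> bool" where
  "is_real_field a \<longleftrightarrow> (\<exists>\<phi>::'k \<Rightarrow> real. bij \<phi> \<and> (\<forall>x y. \<phi> (x + y) = \<phi> x + \<phi> y)
      \<and> (\<forall>x y. \<phi> (x * y) = \<phi> x * \<phi> y) \<and> \<phi> 1 = 1
      \<and> homeomorphic_map (ktop a) euclideanreal \<phi>)"

definition tvs :: "('k::field \<Rightarrow> real) \<Rightarrow> ('k \<Rightarrow> 'v::ab_group_add \<Rightarrow> 'v) \<Rightarrow> 'v topology \<Rightarrow> bool" where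
  "tvs a sm T \<longleftrightarrow> topspace T = UNIV \<and> Hausdorff_space T
     \<and> (\<forall>t x y. sm t (x + y) = sm t x + sm t y)
     \<and> (\<forall>s t x. sm (s + t) x = sm s x + sm t x)
     \<and> (\<forall>s t x. sm (s * t) x = sm s (sm t x))
     \<and> (\<forall>x. sm 1 x = x)
     \<and> continuous_map (prod_topology T T) T (\<lambda>(x, y). x + y)
     \<and> continuous_map (prod_topology (ktop a) T) T (\<lambda>(t, x). sm t x)"

definition zero_nbhd :: "'v::zero topology \<Rightarrow> 'v set \<Rightarrow> bool" where
  "zero_nbhd T W \<longleftrightarrow> (\<exists>Ov. openin T Ov \<and> 0 \<in> Ov \<and> Ov \<subseteq> W)"

definition bounded_set :: "('k::field \<Rightarrow> real) \<Rightarrow> ('k \<Rightarrow> 'v::ab_group_add \<Rightarrow> 'v) \<Rightarrow> 'v topology \<Rightarrow> 'v set \<Rightarrow> bool" where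
  "bounded_set a sm T B \<longleftrightarrow> (\<forall>W. zero_nbhd T W \<longrightarrow>
      (\<exists>V. zero_nbhd (ktop a) V \<and> (\<forall>t\<in>V. \<forall>b\<in>B. sm t b \<in> W)))"

definition mackey_cauchy :: "('k::field \<Rightarrow> real) \<Rightarrow> ('k \<Rightarrow> 'v::ab_group_add \<Rightarrow> 'v) \<Rightarrow> 'v topology \<Rightarrow> (nat \<Rightarrow> 'v) \<Rightarrow> bool" where
  "mackey_cauchy a sm T x \<longleftrightarrow> (\<exists>B \<mu>. bounded_set a sm T B
      \<and> (\<forall>n m. x n - x m \<in> sm (\<mu> n m) ` B)
      \<and> (\<forall>\<epsilon>>0. \<exists>N. \<forall>n\<ge>N. \<forall>m\<ge>N. a (\<mu> n m) < \<epsilon>))"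

definition mackey_complete :: "('k::field \<Rightarrow> real) \<Rightarrow> ('k \<Rightarrow> 'v::ab_group_add \<Rightarrow> 'v) \<Rightarrow> 'v topology \<Rightarrow> bool" where
  "mackey_complete a sm T \<longleftrightarrow>
     (\<forall>x. mackey_cauchy a sm T x \<longrightarrow> (\<exists>l. limitin T x l sequentially))"

definition ultra_seminorm :: "('k::field \<Rightarrow> real) \<Rightarrow> ('k \<Rightarrow> 'v::ab_group_add \<Rightarrow> 'v) \<Rightarrow> ('v \<Rightarrow> real) \<Rightarrow> bool" where
  "ultra_seminorm a sm p \<longleftrightarrow> (\<forall>x. 0 \<le> p x) \<and> (\<forall>t x. p (sm t x) = a t * p x)
     \<and> (\<forall>x y. p (x + y) \<le> max (p x) (p y))"

definition defined_by_seminorms :: "'v::ab_group_add topology \<Rightarrow> ('v \<Rightarrow> real) set \<Rightarrow> bool" where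
  "defined_by_seminorms T P \<longleftrightarrow> (\<forall>U. openin T U \<longleftrightarrow>
     (\<forall>x\<in>U. \<exists>Q \<epsilon>. finite Q \<and> Q \<subseteq> P \<and> \<epsilon> > 0 \<and> {y. \<forall>p\<in>Q. p (y - x) < \<epsilon>} \<subseteq> U))"

text \<open>Convexity over the real field K (s in [0,1] iff s and 1-s are squares in K).\<close>
definition convex_K :: "('k::field \<Rightarrow> 'v::ab_group_add \<Rightarrow> 'v) \<Rightarrow> 'v set \<Rightarrow> bool" where
  "convex_K sm A \<longleftrightarrow> (\<forall>x\<in>A. \<forall>y\<in>A. \<forall>s. (\<exists>c. s = c * c) \<and> (\<exists>d. 1 - s = d * d)
      \<longrightarrow> sm s x + sm (1 - s) y \<in> A)"

definition locally_convex :: "('k::field \<Rightarrow> real) \<Rightarrow> ('k \<Rightarrow> 'v::ab_group_add \<Rightarrow> 'v) \<Rightarrow> 'v topology \<Rightarrow> bool" where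
  "locally_convex a sm T \<longleftrightarrow>
     (if totally_disconnected_top (ktop a)
      then (\<exists>P. (\<forall>p\<in>P. ultra_seminorm a sm p) \<and> defined_by_seminorms T P)
      else (\<forall>W. zero_nbhd T W \<longrightarrow> (\<exists>A. zero_nbhd T A \<and> A \<subseteq> W \<and> convex_K sm A)))"

definition gauge :: "('k::field \<Rightarrow> real) \<Rightarrow> ('k \<Rightarrow> 'v::ab_group_add \<Rightarrow> 'v) \<Rightarrow> 'v topology \<Rightarrow> ('v \<Rightarrow> real) \<Rightarrow> bool" where
  "gauge a sm T q \<longleftrightarrow> (\<forall>x. 0 \<le> q x) \<and> (\<forall>t x. q (sm t x) = a t * q x)
     \<and> (\<forall>r>0. zero_nbhd T {x. q x < r})"

definition lin_functional :: "('k::field \<Rightarrow> 'v::ab_group_add \<Rightarrow> 'v) \<Rightarrow> ('v \<Rightarrow> 'k) \<Rightarrow> bool" where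
  "lin_functional sm l \<longleftrightarrow> (\<forall>x y. l (x + y) = l x + l y) \<and> (\<forall>t x. l (sm t x) = t * l x)"

text \<open>Points of E^[j] = E^[j-1] x E^[j-1] x K are encoded as binary trees of depth j;
  E^[0] = E is encoded by the leaves.\<close>
datatype ('e, 'k) bpt = BLeaf 'e | BNode "('e, 'k) bpt" "('e, 'k) bpt" 'k

primrec lev :: "nat \<Rightarrow> ('e, 'k) bpt set" where
  "lev 0 = range BLeaf"
| "lev (Suc n) = {BNode p q t | p q t. p \<in> lev n \<and> q \<in> lev n}"

primrec pzero :: "nat \<Rightarrow> ('e::zero, 'k::zero) bpt" where
  "pzero 0 = BLeaf 0"
| "pzero (Suc n) = BNode (pzero n) (pzero n) 0"

fun padd :: "('e::plus, 'k::plus) bpt \<Rightarrow> ('e, 'k) bpt \<Rightarrow> ('e, 'k) bpt" where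
  "padd (BLeaf x) (BLeaf y) = BLeaf (x + y)"
| "padd (BNode p q s) (BNode p' q' s') = BNode (padd p p') (padd q q') (s + s')"
| "padd _ _ = undefined"

fun psub :: "('e::minus, 'k::minus) bpt \<Rightarrow> ('e, 'k) bpt \<Rightarrow> ('e, 'k) bpt" where
  "psub (BLeaf x) (BLeaf y) = BLeaf (x - y)"
| "psub (BNode p q s) (BNode p' q' s') = BNode (psub p p') (psub q q') (s - s')"
| "psub _ _ = undefined"

primrec psmul :: "('k::times \<Rightarrow> 'e \<Rightarrow> 'e) \<Rightarrow> 'k \<Rightarrow> ('e, 'k) bpt \<Rightarrow> ('e, 'k) bpt" where
  "psmul sm t (BLeaf x) = BLeaf (sm t x)"
| "psmul sm t (BNode p q s) = BNode (psmul sm t p) (psmul sm t q) (t * s)"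

primrec ptop :: "('k::field \<Rightarrow> real) \<Rightarrow> 'e topology \<Rightarrow> nat \<Rightarrow> ('e, 'k) bpt topology" where
  "ptop a T 0 = topology (\<lambda>S. S \<subseteq> range BLeaf \<and> openin T (BLeaf -` S))"
| "ptop a T (Suc n) = topology (\<lambda>S. S \<subseteq> lev (Suc n) \<and>
     openin (prod_topology (ptop a T n) (prod_topology (ptop a T n) (ktop a)))
       {(p, q, t). p \<in> lev n \<and> q \<in> lev n \<and> BNode p q t \<in> S})"

primrec pdom :: "('k::field \<Rightarrow> 'e::ab_group_add \<Rightarrow> 'e) \<Rightarrow> 'e set \<Rightarrow> nat \<Rightarrow> ('e, 'k) bpt set" where
  "pdom sm U 0 = BLeaf ` U"
| "pdom sm U (Suc n) = {BNode x y t | x y t. x \<in> pdom sm U n \<and> y \<in> lev n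
      \<and> padd x (psmul sm t y) \<in> pdom sm U n}"

definition pgauge :: "('k::field \<Rightarrow> real) \<Rightarrow> ('k \<Rightarrow> 'e::ab_group_add \<Rightarrow> 'e) \<Rightarrow> 'e topology \<Rightarrow> nat
     \<Rightarrow> (('e, 'k) bpt \<Rightarrow> real) \<Rightarrow> bool" where
  "pgauge a sm T j q \<longleftrightarrow> (\<forall>x\<in>lev j. 0 \<le> q x) \<and> (\<forall>t. \<forall>x\<in>lev j. q (psmul sm t x) = a t * q x)
     \<and> (\<forall>r>0. \<exists>Ov. openin (ptop a T j) Ov \<and> pzero j \<in> Ov \<and> Ov \<subseteq> {x \<in> lev j. q x < r})"

definition holder0 :: "('k::field \<Rightarrow> real) \<Rightarrow> ('k \<Rightarrow> 'e::ab_group_add \<Rightarrow> 'e) \<Rightarrow> 'e topology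
     \<Rightarrow> ('k \<Rightarrow> 'c::ab_group_add \<Rightarrow> 'c) \<Rightarrow> 'c topology \<Rightarrow> real \<Rightarrow> nat \<Rightarrow> ('e, 'k) bpt set
     \<Rightarrow> (('e, 'k) bpt \<Rightarrow> 'c) \<Rightarrow> bool" where
  "holder0 a smE TE smC TC \<sigma> j D h \<longleftrightarrow> (\<forall>x0\<in>D. \<forall>q. gauge a smC TC q \<longrightarrow>
      (\<exists>p W. pgauge a smE TE j p \<and> W \<subseteq> D
         \<and> (\<exists>Ov. openin (ptop a TE j) Ov \<and> x0 \<in> Ov \<and> Ov \<inter> D \<subseteq> W)
         \<and> (\<forall>x\<in>W. \<forall>y\<in>W. q (h y - h x) \<le> (p (psub y x)) powr \<sigma>)))"

text \<open>hs j plays the role of g^[j] (for j \<le> k): hs 0 = g on U, each hs j is continuous on U^[j],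
  and hs (j+1) is a continuous extension of the difference quotient of hs j.\<close>
definition bgn_seq :: "('k::field \<Rightarrow> real) \<Rightarrow> ('k \<Rightarrow> 'e::ab_group_add \<Rightarrow> 'e) \<Rightarrow> 'e topology
     \<Rightarrow> ('k \<Rightarrow> 'c::ab_group_add \<Rightarrow> 'c) \<Rightarrow> 'c topology \<Rightarrow> enat \<Rightarrow> 'e set \<Rightarrow> ('e \<Rightarrow> 'c)
     \<Rightarrow> (nat \<Rightarrow> ('e, 'k) bpt \<Rightarrow> 'c) \<Rightarrow> bool" where
  "bgn_seq a smE TE smC TC k U g hs \<longleftrightarrow>
     (\<forall>x\<in>U. hs 0 (BLeaf x) = g x)
     \<and> (\<forall>j. enat j \<le> k \<longrightarrow> continuous_map (subtopology (ptop a TE j) (pdom smE U j)) TC (hs j))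
     \<and> (\<forall>j. enat (Suc j) \<le> k \<longrightarrow> (\<forall>x y t. BNode x y t \<in> pdom smE U (Suc j) \<and> t \<noteq> 0 \<longrightarrow>
          hs (Suc j) (BNode x y t) = smC (inverse t) (hs j (padd x (psmul smE t y)) - hs j x)))"

definition C_BGN :: "('k::field \<Rightarrow> real) \<Rightarrow> ('k \<Rightarrow> 'e::ab_group_add \<Rightarrow> 'e) \<Rightarrow> 'e topology
     \<Rightarrow> ('k \<Rightarrow> 'c::ab_group_add \<Rightarrow> 'c) \<Rightarrow> 'c topology \<Rightarrow> enat \<Rightarrow> 'e set \<Rightarrow> ('e \<Rightarrow> 'c) \<Rightarrow> bool" where
  "C_BGN a smE TE smC TC k U g \<longleftrightarrow> (\<exists>hs. bgn_seq a smE TE smC TC k U g hs)"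

definition C_BGN_holder :: "('k::field \<Rightarrow> real) \<Rightarrow> ('k \<Rightarrow> 'e::ab_group_add \<Rightarrow> 'e) \<Rightarrow> 'e topology
     \<Rightarrow> ('k \<Rightarrow> 'c::ab_group_add \<Rightarrow> 'c) \<Rightarrow> 'c topology \<Rightarrow> enat \<Rightarrow> real \<Rightarrow> 'e set \<Rightarrow> ('e \<Rightarrow> 'c) \<Rightarrow> bool" where
  "C_BGN_holder a smE TE smC TC k \<sigma> U g \<longleftrightarrow> (\<exists>hs. bgn_seq a smE TE smC TC k U g hs
      \<and> (\<forall>j. enat j \<le> k \<longrightarrow> holder0 a smE TE smC TC \<sigma> j (pdom smE U j) (hs j)))"

end

theory Submission
  imports Defs
begin

text \<open>
  Everything rests on Mackey's theorem that weakly bounded subsets of F are bounded. Applied to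
  differences of function values divided by suitable scalars, it turns weak Hoelder estimates
  into Hoelder estimates; metrizability of E makes it enough to consider sequences of points.
  The value of the difference quotient at t = 0 is obtained along a sequence of nonzero scalars
  tending to 0: weak Hoelder continuity and Mackey's theorem show that the quotients form a
  Mackey--Cauchy sequence. Since the functionals separate points, the iterated difference
  quotients of the compositions with functionals determine those of f.
\<close>

section \<open>Fields with an absolute value\<close>

text \<open>The values \<open>a t\<close> may form a discrete set, so a vector cannot be divided by
  a prescribed positive real, only by a scalar whose size is right up to the factor
  \<open>kap\<close>; this is the origin of every \<open>kap\<close> in the estimates.
  \<open>E\<close> need not be locally convex, so it is measured by gauges, which obey no triangle
  inequality; only their homogeneity and their neighbourhoods are used.

  The exclusion of the complex numbers enters in Hahn--Banach: extending a functional by one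
  dimension asks for a common point of balls that are compatible in pairs. This works on the real
  line and, with \<open>max\<close> in place of the sum, in every locally compact field; pairwise
  meeting discs in the complex plane may have no common point.

  Mackey's theorem has no completeness of the space to lean on, so its series is formed from
  functionals and converges in the scalars.

  Hoelder exponents make the values at t = 0 accessible: each functional sees the quotients at
  scalars of size at most r vary by at most a constant times \<open>r powr \<sigma>\<close>. Only
  the constant depends on the functional, so one sequence of scalars serves them all.\<close>

locale absval =
  fixes a :: "'k::field \<Rightarrow> real"
  assumes av: "abs_value a"
    and small: "\<And>r. r > 0 \<Longrightarrow> \<exists>t. t \<noteq> 0 \<and> a t < r"
begin

lemma a_nonneg [simp]: "0 \<le> a x"
  and a_eq_0 [simp]: "a x = 0 \<longleftrightarrow> x = 0"
  and a_mult: "a (x * y) = a x * a y"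
  and a_add: "a (x + y) \<le> a x + a y"
  using av unfolding abs_value_def by auto

lemma a_0 [simp]: "a 0 = 0"
  by simp

lemma a_pos: "x \<noteq> 0 \<Longrightarrow> 0 < a x"
  using a_nonneg[of x] a_eq_0[of x] by linarith

lemma a_1 [simp]: "a 1 = 1"
proof -
  have "a 1 * a 1 = a 1" using a_mult[of 1 1] by simp
  then show ?thesis using a_eq_0[of 1] by simp
qed

lemma a_minus [simp]: "a (- x) = a x"
proof -
  have "a (-1) * a (-1) = 1" using a_mult[of "-1" "-1"] by simp
  then have "a (-1) = 1" using a_nonneg[of "-1"]
    by (metis abs_of_nonneg abs_1 abs_mult_self_eq one_power2 power2_eq_iff power2_eq_square
        abs_minus_cancel)
  then show ?thesis using a_mult[of "-1" x] by simp
qed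

lemma a_diff_commute: "a (x - y) = a (y - x)"
  using a_minus[of "x - y"] by simp

lemma a_diff_triangle: "a (x - z) \<le> a (x - y) + a (y - z)"
  using a_add[of "x - y" "y - z"] by simp

lemma a_inverse: "x \<noteq> 0 \<Longrightarrow> a (inverse x) = inverse (a x)"
  using a_mult[of x "inverse x"] a_pos[of x] by (simp add: field_simps)

lemma a_power: "a (x ^ n) = a x ^ n"
  by (induction n) (auto simp: a_mult)

lemma large: "\<exists>t. t \<noteq> 0 \<and> R < a t"
proof -
  obtain t where t: "t \<noteq> 0" "a t < inverse (\<bar>R\<bar> + 1)" using small[of "inverse (\<bar>R\<bar> + 1)"]
    by (metis abs_ge_zero add_nonneg_pos inverse_positive_iff_positive zero_less_one)
  then have "\<bar>R\<bar> + 1 < a (inverse t)"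
    using less_imp_inverse_less[OF t(2)] a_pos[of t] by (simp add: a_inverse)
  then show ?thesis using t by (intro exI[of _ "inverse t"]) auto
qed

definition unif :: 'k where "unif = (SOME t. t \<noteq> 0 \<and> a t < 1)"

definition kap :: real where "kap = a unif"

lemma unif: "unif \<noteq> 0" "a unif < 1"
  using someI_ex[OF small[of 1]] unfolding unif_def by auto

lemma kap: "0 < kap" "kap < 1"
  using unif a_pos unfolding kap_def by auto

text \<open>Multiplying a large scalar by successive powers of \<open>unif\<close> shrinks its size
  by the factor \<open>kap\<close> each time, so the first power that brings it below
  \<open>R\<close> overshoots by at most that factor.\<close>

lemma scalar_approx:
  assumes "R > 0" obtains t where "t \<noteq> 0" "kap * R \<le> a t" "a t < R"
proof -
  obtain u where u: "u \<noteq> 0" "R < a u" using large by blast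
  have "\<exists>n. a u * kap ^ n < R"
  proof -
    obtain n where "kap ^ n < R / a u"
      using real_arch_pow_inv[of "R / a u" kap] kap assms u a_pos by (auto simp: zero_less_divide_iff)
    then show ?thesis using a_pos[OF u(1)] by (auto simp: field_simps)
  qed
  then obtain n where n: "a u * kap ^ n < R" "\<And>m. m < n \<Longrightarrow> \<not> a u * kap ^ m < R"
    using exists_least_iff[of "\<lambda>n. a u * kap ^ n < R"] by blast
  have "n \<noteq> 0" using n u by (cases n) auto
  then obtain m where m: "n = Suc m" by (cases n) auto
  have "R \<le> a u * kap ^ m" using n(2)[of m] m by auto
  then have "kap * R \<le> a u * kap ^ n"
    unfolding m using kap by (simp add: mult_left_mono algebra_simps)
  then show ?thesis using that[of "u * unif ^ n"] n(1) u unif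
    by (simp add: a_mult a_power kap_def)
qed

text \<open>Turns an inclusion of balls into a domination of homogeneous functions: \<open>r\<close>
  and \<open>p\<close> stand for their values at one vector, which is scaled to size just below
  \<delta>. If \<open>r = 0\<close>, arbitrarily large scalars are admissible, which forces
  \<open>p \<le> 0\<close>.\<close>

lemma homogeneous_le:
  assumes "0 \<le> r" "0 < \<delta>" and imp: "\<And>t. a t * r < \<delta> \<Longrightarrow> a t * p < 1"
  shows "p \<le> inverse (kap * \<delta>) * r"
proof (cases "r = 0")
  case True
  have "p \<le> 0"
  proof (rule ccontr)
    assume "\<not> p \<le> 0"
    moreover obtain t where "t \<noteq> 0" "inverse p < a t" using large by blast
    moreover have "a t * p < 1" using imp True assms by auto
    ultimately show False by (simp add: field_simps)
  qed
  then show ?thesis using True by simp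
next
  case False
  then have r: "r > 0" using assms by simp
  obtain t where t: "t \<noteq> 0" "kap * (\<delta> / r) \<le> a t" "a t < \<delta> / r"
    using scalar_approx[of "\<delta> / r"] r assms by auto
  have "a t * p < 1" using imp t r by (simp add: field_simps)
  then have "p < inverse (a t)" using a_pos[OF t(1)] by (simp add: field_simps)
  also have "\<dots> \<le> inverse (kap * (\<delta> / r))"
    using t kap r assms by (intro le_imp_inverse_le) auto
  finally show ?thesis using r by (simp add: field_simps)
qed

lemma Metric: "Metric_space UNIV (\<lambda>x y. a (x - y))"
  by unfold_locales (auto simp: a_diff_commute intro: a_diff_triangle order_trans)

lemma ktop_eq: "ktop a = Metric_space.mtopology UNIV (\<lambda>x y. a (x - y))"
proof -
  interpret Metric_space UNIV "\<lambda>x y. a (x - y)" by (rule Metric)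
  show ?thesis
    unfolding ktop_def mtopology_def mopen_def
    by (rule arg_cong[where f = topology]) (auto simp: fun_eq_iff mball_def subset_iff a_diff_commute)
qed

lemma openin_ktop: "openin (ktop a) S \<longleftrightarrow> (\<forall>x\<in>S. \<exists>r>0. \<forall>y. a (y - x) < r \<longrightarrow> y \<in> S)"
proof -
  interpret Metric_space UNIV "\<lambda>x y. a (x - y)" by (rule Metric)
  show ?thesis unfolding ktop_eq openin_mtopology
    by (auto simp: mball_def subset_iff a_diff_commute)
qed

lemma topspace_ktop [simp]: "topspace (ktop a) = UNIV"
proof -
  interpret Metric_space UNIV "\<lambda>x y. a (x - y)" by (rule Metric)
  show ?thesis unfolding ktop_eq by simp
qed

lemma ball_open: "openin (ktop a) {y. a (y - x) < r}"
  unfolding openin_ktop mem_Collect_eq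
proof safe
  fix z assume z: "a (z - x) < r"
  have "a (y - x) < r" if "a (y - z) < r - a (z - x)" for y
    using a_diff_triangle[of y x z] that by simp
  then show "\<exists>d>0. \<forall>y. a (y - z) < d \<longrightarrow> a (y - x) < r"
    using z by (auto intro!: exI[of _ "r - a (z - x)"])
qed

lemma zero_nbhd_ktop: "zero_nbhd (ktop a) W \<longleftrightarrow> (\<exists>r>0. \<forall>t. a t < r \<longrightarrow> t \<in> W)"
proof
  assume "zero_nbhd (ktop a) W"
  then show "\<exists>r>0. \<forall>t. a t < r \<longrightarrow> t \<in> W"
    unfolding zero_nbhd_def openin_ktop by (metis diff_zero subsetD)
next
  assume "\<exists>r>0. \<forall>t. a t < r \<longrightarrow> t \<in> W"
  then obtain r where "r > 0" "\<forall>t. a t < r \<longrightarrow> t \<in> W" by blast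
  then show "zero_nbhd (ktop a) W" unfolding zero_nbhd_def
    using ball_open[of 0 r] by (intro exI[of _ "{y. a (y - 0) < r}"]) auto
qed

lemma gauge_absval: "gauge a (*) (ktop a) a"
  unfolding gauge_def by (auto simp: a_mult zero_nbhd_ktop)

lemma continuous_map_ktop:
  "continuous_map X (ktop a) g \<longleftrightarrow>
    (\<forall>x\<in>topspace X. \<forall>\<epsilon>>0. \<exists>O'. openin X O' \<and> x \<in> O' \<and> (\<forall>y\<in>O'. a (g y - g x) < \<epsilon>))"
proof -
  interpret Metric_space UNIV "\<lambda>x y. a (x - y)" by (rule Metric)
  show ?thesis unfolding ktop_eq continuous_map_to_metric
    by (auto simp: mball_def a_diff_commute) 
qed

lemma limitin_ktop:
  "limitin (ktop a) x l sequentially \<longleftrightarrow> (\<forall>\<epsilon>>0. \<exists>N. \<forall>n\<ge>N. a (x n - l) < \<epsilon>)"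
proof -
  interpret Metric_space UNIV "\<lambda>x y. a (x - y)" by (rule Metric)
  show ?thesis unfolding ktop_eq limitin_metric by (auto simp: eventually_sequentially)
qed

end

text \<open>Non-discreteness yields nonzero scalars of arbitrarily small size. The topology axioms
  are checked by hand because the metric description of \<open>ktop\<close> lives inside the locale
  being established.\<close>

lemma locally_compact_field_absval:
  assumes "locally_compact_field a" shows "absval a"
proof -
  have av: "abs_value a" and no: "\<not> openin (ktop a) {0}"
    using assms unfolding locally_compact_field_def by auto
  have "istopology (\<lambda>S. \<forall>x\<in>S. \<exists>r>0. \<forall>y. a (y - x) < r \<longrightarrow> y \<in> S)"
    unfolding istopology_def
  proof (intro conjI allI impI ballI)
    fix S S' x assume S: "\<forall>x\<in>S. \<exists>r>0. \<forall>y. a (y - x) < r \<longrightarrow> y \<in> S"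
      "\<forall>x\<in>S'. \<exists>r>0. \<forall>y. a (y - x) < r \<longrightarrow> y \<in> S'" and x: "x \<in> S \<inter> S'"
    then obtain r r' where "r > 0" "\<forall>y. a (y - x) < r \<longrightarrow> y \<in> S" "r' > 0"
      "\<forall>y. a (y - x) < r' \<longrightarrow> y \<in> S'" by blast
    then show "\<exists>r>0. \<forall>y. a (y - x) < r \<longrightarrow> y \<in> S \<inter> S'"
      by (intro exI[of _ "min r r'"]) auto
  qed (meson UnionE UnionI)
  then have "openin (ktop a) S = (\<forall>x\<in>S. \<exists>r>0. \<forall>y. a (y - x) < r \<longrightarrow> y \<in> S)" for S
    unfolding ktop_def by (simp add: topology_inverse')
  then have "\<forall>r>0. \<exists>y. a y < r \<and> y \<noteq> 0" using no by auto
  then show ?thesis using av unfolding absval_def by blast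
qed

section \<open>Topological vector spaces and gauges\<close>

lemma openin_prodE:
  assumes "openin (prod_topology X Y) S" "(x, y) \<in> S"
  obtains U V where "openin X U" "openin Y V" "x \<in> U" "y \<in> V" "U \<times> V \<subseteq> S"
proof -
  have "\<exists>U V. openin X U \<and> openin Y V \<and> x \<in> U \<and> y \<in> V \<and> U \<times> V \<subseteq> S"
    using assms unfolding openin_prod_topology_alt by (elim allE impE)
  then show ?thesis using that by (elim exE conjE)
qed

lemma zero_nbhd_mono: "zero_nbhd T V \<Longrightarrow> V \<subseteq> W \<Longrightarrow> zero_nbhd T W"
  unfolding zero_nbhd_def by blast

lemma zero_nbhd_0: "zero_nbhd T V \<Longrightarrow> 0 \<in> V"
  unfolding zero_nbhd_def by blast

lemma zero_nbhd_Int: "zero_nbhd T V \<Longrightarrow> zero_nbhd T W \<Longrightarrow> zero_nbhd T (V \<inter> W)"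
  unfolding zero_nbhd_def by (meson IntI Int_mono openin_Int)

locale absval_tvs = absval a
  for a :: "'k::field \<Rightarrow> real" +
  fixes sm :: "'k \<Rightarrow> 'v::ab_group_add \<Rightarrow> 'v" and T :: "'v topology"
  assumes tvs: "tvs a sm T"
begin

lemma topspace_T [simp]: "topspace T = UNIV"
  and Hausdorff: "Hausdorff_space T"
  and sm_add: "sm t (x + y) = sm t x + sm t y"
  and sm_add_left: "sm (s + t) x = sm s x + sm t x"
  and sm_mult: "sm (s * t) x = sm s (sm t x)"
  and sm_1 [simp]: "sm 1 x = x"
  and cont_add: "continuous_map (prod_topology T T) T (\<lambda>(x, y). x + y)"
  and cont_sm: "continuous_map (prod_topology (ktop a) T) T (\<lambda>(t, x). sm t x)"
  using tvs unfolding tvs_def by auto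

lemma sm_0_right [simp]: "sm t 0 = 0"
  using sm_add[of t 0 0] by simp

lemma sm_0_left [simp]: "sm 0 x = 0"
  using sm_add_left[of 0 0 x] by simp

lemma sm_minus: "sm t (- x) = - sm t x"
  using sm_add[of t x "- x"] by (simp add: eq_neg_iff_add_eq_0 add.commute)

lemma sm_minus_left: "sm (- t) x = - sm t x"
  using sm_add_left[of t "- t" x] by (simp add: eq_neg_iff_add_eq_0 add.commute)

lemma sm_diff: "sm t (x - y) = sm t x - sm t y"
  using sm_add[of t x "- y"] by (simp add: sm_minus)

lemma sm_inverse: "t \<noteq> 0 \<Longrightarrow> sm (inverse t) (sm t x) = x" "t \<noteq> 0 \<Longrightarrow> sm t (sm (inverse t) x) = x"
  using sm_mult[of "inverse t" t x] sm_mult[of t "inverse t" x] by auto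

lemma cont_pair:
  assumes "continuous_map X T f" "continuous_map X T g"
  shows "continuous_map X T (\<lambda>x. f x + g x)"
  using continuous_map_compose[OF _ cont_add, of X "\<lambda>x. (f x, g x)"] assms
  by (simp add: o_def continuous_map_pairwise)

lemma cont_scale:
  assumes "continuous_map X (ktop a) f" "continuous_map X T g"
  shows "continuous_map X T (\<lambda>x. sm (f x) (g x))"
  using continuous_map_compose[OF _ cont_sm, of X "\<lambda>x. (f x, g x)"] assms
  by (simp add: o_def continuous_map_pairwise)

lemma cont_translate: "continuous_map T T (\<lambda>x. c + x)"
  by (rule cont_pair) auto

lemma cont_scalar: "continuous_map T T (sm t)"
  using cont_scale[of T "\<lambda>_. t" "\<lambda>x. x"] by simp

lemma openin_translate: "openin T S \<Longrightarrow> openin T {x. c + x \<in> S}"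
  using openin_continuous_map_preimage[OF cont_translate, of S c] by simp

lemma zero_nbhd_translate: "openin T S \<Longrightarrow> x \<in> S \<Longrightarrow> zero_nbhd T {y. x + y \<in> S}"
  unfolding zero_nbhd_def using openin_translate[of S x] by fastforce

lemma nbhd_translate:
  assumes "zero_nbhd T W" obtains S where "openin T S" "x \<in> S" "\<And>y. y \<in> S \<Longrightarrow> y - x \<in> W"
proof -
  obtain S where "openin T S" "0 \<in> S" "S \<subseteq> W" using assms unfolding zero_nbhd_def by blast
  then show ?thesis using that[of "{y. - x + y \<in> S}"] openin_translate[of S "-x"] by auto
qed

lemma zero_nbhd_scale:
  assumes "zero_nbhd T W" shows "zero_nbhd T {x. sm t x \<in> W}"
proof -
  obtain S where S: "openin T S" "0 \<in> S" "S \<subseteq> W" using assms unfolding zero_nbhd_def by blast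
  then show ?thesis unfolding zero_nbhd_def
    using openin_continuous_map_preimage[OF cont_scalar S(1), of t]
    by (intro exI[of _ "{x \<in> topspace T. sm t x \<in> S}"]) auto
qed

lemma scalar_at_zero:
  assumes "zero_nbhd T W"
  obtains \<delta> V where "\<delta> > 0" "zero_nbhd T V" "\<And>t x. a t < \<delta> \<Longrightarrow> x \<in> V \<Longrightarrow> sm t x \<in> W"
proof -
  obtain S where S: "openin T S" "0 \<in> S" "S \<subseteq> W" using assms unfolding zero_nbhd_def by blast
  have "openin (prod_topology (ktop a) T) {z. (case z of (t, x) \<Rightarrow> sm t x) \<in> S}"
    using openin_continuous_map_preimage[OF cont_sm S(1)] by simp
  moreover have "(0, 0) \<in> {z. (case z of (t, x) \<Rightarrow> sm t x) \<in> S}" using S(2) by simp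
  ultimately obtain A V where A: "openin (ktop a) A" "openin T V" "0 \<in> A" "0 \<in> V"
    and AV: "A \<times> V \<subseteq> {z. (case z of (t, x) \<Rightarrow> sm t x) \<in> S}"
    by (rule openin_prodE)
  obtain \<delta> where d: "\<delta> > 0" "\<And>t. a (t - 0) < \<delta> \<Longrightarrow> t \<in> A"
    using A(1,3) unfolding openin_ktop by blast
  have "sm t x \<in> W" if "a t < \<delta>" "x \<in> V" for t x
    using d(2)[of t] that AV S(3) by auto
  moreover have "zero_nbhd T V" unfolding zero_nbhd_def using A by blast
  ultimately show ?thesis using that[of \<delta> V] d(1) by simp
qed

lemma absorbing:
  assumes "zero_nbhd T W" obtains \<delta> where "\<delta> > 0" "\<And>t. a t < \<delta> \<Longrightarrow> sm t x \<in> W"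
proof -
  have "continuous_map (ktop a) T (\<lambda>t. sm t x)" by (rule cont_scale) auto
  obtain S where S: "openin T S" "0 \<in> S" "S \<subseteq> W" using assms unfolding zero_nbhd_def by blast
  have "openin (ktop a) {t. sm t x \<in> S}"
    using openin_continuous_map_preimage[OF \<open>continuous_map (ktop a) T (\<lambda>t. sm t x)\<close> S(1)] by simp
  then obtain \<delta> where "\<delta> > 0" "\<And>t. a t < \<delta> \<Longrightarrow> sm t x \<in> S"
    unfolding openin_ktop using S(2) by (metis (no_types, lifting) diff_zero mem_Collect_eq sm_0_left)
  then show ?thesis using that S by blast
qed

lemma zero_nbhds_separate:
  assumes "\<And>W. zero_nbhd T W \<Longrightarrow> v \<in> W" shows "v = 0"
proof (rule ccontr)
  assume "v \<noteq> 0"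
  then obtain S where "openin T S" "0 \<in> S" "v \<notin> S"
    using Hausdorff unfolding Hausdorff_space_def by (metis UNIV_I disjnt_iff topspace_T)
  then show False using assms[of S] unfolding zero_nbhd_def by blast
qed

section \<open>Balanced neighbourhoods and their gauges\<close>

lemma balanced_nbhd:
  assumes "zero_nbhd T W"
  obtains V where "zero_nbhd T V" "V \<subseteq> W" "\<And>t x. a t \<le> 1 \<Longrightarrow> x \<in> V \<Longrightarrow> sm t x \<in> V"
proof -
  obtain \<delta> S where d: "\<delta> > 0" "zero_nbhd T S" "\<And>t x. a t < \<delta> \<Longrightarrow> x \<in> S \<Longrightarrow> sm t x \<in> W"
    using scalar_at_zero[OF assms] by blast
  \<comment> \<open>The strict bound on \<open>a t\<close> is stable under multiplication by scalars
    of size at most 1, which makes this set balanced; it is a neighbourhood because it contains the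
    image of \<open>S\<close> under one nonzero scalar.\<close>
  define V where "V = {sm t x | t x. a t < \<delta> \<and> x \<in> S}"
  obtain c where c: "c \<noteq> 0" "a c < \<delta>" using small d(1) by blast
  have "{x. sm (inverse c) x \<in> S} \<subseteq> V"
  proof
    fix x assume "x \<in> {x. sm (inverse c) x \<in> S}"
    then show "x \<in> V" unfolding V_def using c sm_inverse(2)[OF c(1), of x]
      by (auto intro!: exI[of _ c] exI[of _ "sm (inverse c) x"])
  qed
  then have "zero_nbhd T V" using zero_nbhd_scale[OF d(2)] zero_nbhd_mono by blast
  moreover have "sm t x \<in> V" if t: "a t \<le> 1" and x: "x \<in> V" for t x
  proof -
    obtain s y where s: "x = sm s y" "a s < \<delta>" "y \<in> S" using x V_def by blast
    have "a (t * s) < \<delta>" using s t by (smt (verit) a_mult a_nonneg mult_left_le_one_le)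
    moreover have "sm t x = sm (t * s) y" using s sm_mult by simp
    ultimately show ?thesis unfolding V_def using s(3) by blast
  qed
  ultimately show ?thesis using that[of V] d(3) V_def by blast
qed

text \<open>The Minkowski functional with dilations restricted to scalars of the field. Without
  convexity of \<open>V\<close> it is only a gauge; in the real case a convex \<open>V\<close> will
  turn it into a seminorm.\<close>

definition mink :: "'v set \<Rightarrow> 'v \<Rightarrow> real" where
  "mink V x = Inf {a t | t. t \<noteq> 0 \<and> sm (inverse t) x \<in> V}"

lemma mink_le: "t \<noteq> 0 \<Longrightarrow> sm (inverse t) x \<in> V \<Longrightarrow> mink V x \<le> a t"
  unfolding mink_def by (rule cInf_lower) (auto intro!: bdd_belowI[of _ 0])

context
  fixes V assumes V: "zero_nbhd T V"
    and bal: "\<And>t x. a t \<le> 1 \<Longrightarrow> x \<in> V \<Longrightarrow> sm t x \<in> V"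
begin

lemma mink_nonempty: "{a t | t. t \<noteq> 0 \<and> sm (inverse t) x \<in> V} \<noteq> {}"
proof -
  obtain \<delta> where d: "\<delta> > 0" "\<And>t. a t < \<delta> \<Longrightarrow> sm t x \<in> V" using absorbing[OF V] by blast
  obtain t where "t \<noteq> 0" "a t < \<delta>" using small d by blast
  then show ?thesis using d(2)[of t] by (auto intro!: exI[of _ "inverse t"])
qed

lemma mink_less: "mink V x < r \<longleftrightarrow> (\<exists>t. t \<noteq> 0 \<and> sm (inverse t) x \<in> V \<and> a t < r)"
  unfolding mink_def
  by (subst cInf_less_iff[OF mink_nonempty]) (auto intro!: bdd_belowI[of _ 0])

lemma mink_nonneg: "0 \<le> mink V x"
  unfolding mink_def by (rule cInf_greatest[OF mink_nonempty]) auto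

lemma mink_sub_one: "mink V x < 1 \<Longrightarrow> x \<in> V"
  unfolding mink_less using bal sm_inverse(2) by (metis less_eq_real_def)

lemma mink_scale_le: "u \<noteq> 0 \<Longrightarrow> mink V (sm u x) \<le> a u * mink V x"
proof -
  assume u: "u \<noteq> 0"
  have "mink V (sm u x) / a u \<le> mink V x"
    unfolding mink_def[of V x]
  proof (rule cInf_greatest[OF mink_nonempty])
    fix r assume "r \<in> {a t | t. t \<noteq> 0 \<and> sm (inverse t) x \<in> V}"
    then obtain t where t: "r = a t" "t \<noteq> 0" "sm (inverse t) x \<in> V" by blast
    have "sm (inverse (u * t)) (sm u x) = sm (inverse t) x"
    proof -
      have "inverse (u * t) * u = inverse t" using u t by simp
      then show ?thesis by (metis sm_mult)
    qed
    then have "mink V (sm u x) \<le> a (u * t)" using mink_le[of "u * t" "sm u x"] t u by simp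
    then show "mink V (sm u x) / a u \<le> r" using t a_pos[OF u] by (simp add: a_mult field_simps)
  qed
  then show ?thesis using a_pos[OF u] by (simp add: field_simps)
qed

lemma mink_scale: "mink V (sm u x) = a u * mink V x"
proof (cases "u = 0")
  case True
  have "mink V 0 \<le> r" if "r > 0" for r
  proof -
    obtain t where "t \<noteq> 0" "a t < r" using small \<open>r > 0\<close> by blast
    then show ?thesis using mink_le[of t 0 V] zero_nbhd_0[OF V] by simp
  qed
  then have "mink V 0 \<le> 0" by (rule dense_ge)
  then show ?thesis using mink_nonneg[of 0] True by simp
next
  case False
  have "mink V (sm (inverse u) (sm u x)) \<le> a (inverse u) * mink V (sm u x)"
    using False by (intro mink_scale_le) auto
  then have "mink V x \<le> inverse (a u) * mink V (sm u x)"
    using False by (simp only: sm_inverse a_inverse not_False_eq_True)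
  then have "a u * mink V x \<le> mink V (sm u x)"
    using a_pos[OF False] by (simp add: field_simps)
  then show ?thesis using mink_scale_le[OF False, of x] by simp
qed

lemma mink_nbhd: assumes "r > 0" shows "zero_nbhd T {x. mink V x < r}"
proof -
  obtain t where t: "t \<noteq> 0" "a t < r" using small assms by blast
  have "{x. sm (inverse t) x \<in> V} \<subseteq> {x. mink V x < r}" using t mink_less by auto
  then show ?thesis using zero_nbhd_scale[OF V] zero_nbhd_mono by blast
qed

lemma mink_gauge: "gauge a sm T (mink V)"
  unfolding gauge_def by (intro conjI allI impI mink_nonneg mink_scale mink_nbhd)

end

lemma exists_gauge:
  assumes "zero_nbhd T W" obtains q where "gauge a sm T q" "\<And>x. q x < 1 \<Longrightarrow> x \<in> W"
proof -
  obtain V where V: "zero_nbhd T V" "V \<subseteq> W" "\<And>t x. a t \<le> 1 \<Longrightarrow> x \<in> V \<Longrightarrow> sm t x \<in> V"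
    by (rule balanced_nbhd[OF assms]) auto
  show ?thesis
    using that[OF mink_gauge[OF V(1,3)]] mink_sub_one[OF V(1,3)] V(2) by blast
qed

lemma gauge_max:
  assumes "gauge a sm T p" "gauge a sm T q" shows "gauge a sm T (\<lambda>x. max (p x) (q x))"
proof -
  have "zero_nbhd T {x. max (p x) (q x) < r}" if "r > 0" for r
    using zero_nbhd_Int[of T "{x. p x < r}" "{x. q x < r}"] assms that
    unfolding gauge_def by (simp add: Collect_conj_eq)
  moreover have "0 \<le> max (p x) (q x)" for x
    using assms unfolding gauge_def by (simp add: le_max_iff_disj)
  moreover have "max (p (sm t x)) (q (sm t x)) = a t * max (p x) (q x)" for t x
    using assms max_mult_distrib_left[of "a t" "p x" "q x"] unfolding gauge_def by simp
  ultimately show ?thesis unfolding gauge_def by blast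
qed

text \<open>Metrizability enters through first countability. The running maxima make the sequence
  increasing, so an upper bound in terms of one gauge passes to all later ones.\<close>

lemma metrizable_gauges:
  assumes "metrizable_space T"
  obtains p :: "nat \<Rightarrow> 'v \<Rightarrow> real" where "\<And>n. gauge a sm T (p n)" "\<And>m n x. m \<le> n \<Longrightarrow> p m x \<le> p n x"
    "\<And>W. zero_nbhd T W \<Longrightarrow> \<exists>n. {x. p n x < 1} \<subseteq> W"
proof -
  have "first_countable T" using assms by (rule metrizable_imp_first_countable)
  then have "\<exists>\<B>. countable \<B> \<and> (\<forall>V\<in>\<B>. openin T V) \<and>
      (\<forall>U. openin T U \<and> 0 \<in> U \<longrightarrow> (\<exists>V\<in>\<B>. 0 \<in> V \<and> V \<subseteq> U))"
    unfolding first_countable_def by simp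
  then obtain \<B> where B: "countable \<B>" "\<And>V. V \<in> \<B> \<Longrightarrow> openin T V"
    "\<And>U. openin T U \<Longrightarrow> 0 \<in> U \<Longrightarrow> \<exists>V\<in>\<B>. 0 \<in> V \<and> V \<subseteq> U"
    by (auto dest: spec)
  define \<C> where "\<C> = {V\<in>\<B>. 0 \<in> V}"
  have C: "countable \<C>" "\<C> \<noteq> {}"
    using B(1) B(3)[OF openin_topspace] unfolding \<C>_def by (simp_all, blast)
  define W where "W = from_nat_into \<C>"
  have W: "zero_nbhd T (W n)" for n
    unfolding W_def zero_nbhd_def using from_nat_into[OF C(2), of n] B(2) \<C>_def by blast
  define q where "q n = (SOME q. gauge a sm T q \<and> {x. q x < 1} \<subseteq> W n)" for n
  have q: "gauge a sm T (q n) \<and> {x. q n x < 1} \<subseteq> W n" for n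
  proof -
    obtain r where "gauge a sm T r" "\<And>x. r x < 1 \<Longrightarrow> x \<in> W n"
      using exists_gauge[OF W[of n]] by metis
    then have "\<exists>q. gauge a sm T q \<and> {x. q x < 1} \<subseteq> W n" by blast
    then show ?thesis unfolding q_def by (rule someI_ex)
  qed
  define p where "p = rec_nat (q 0) (\<lambda>n r x. max (r x) (q (Suc n) x))"
  have p: "p 0 = q 0" "\<And>n. p (Suc n) = (\<lambda>x. max (p n x) (q (Suc n) x))"
    unfolding p_def by auto
  have "gauge a sm T (p n)" for n by (induction n) (auto simp: p q gauge_max)
  moreover have "p m x \<le> p n x" if "m \<le> n" for m n x
    using that by (induction n rule: dec_induct) (auto simp: p le_max_iff_disj)
  moreover have "\<exists>n. {x. p n x < 1} \<subseteq> S" if S: "zero_nbhd T S" for S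
  proof -
    obtain V where V: "V \<in> \<C>" "V \<subseteq> S"
    proof -
      obtain O' where "openin T O'" "0 \<in> O'" "O' \<subseteq> S" using S unfolding zero_nbhd_def by blast
      moreover from this obtain V where "V \<in> \<B>" "0 \<in> V" "V \<subseteq> O'" using B(3) by meson
      ultimately show ?thesis using that[of V] unfolding \<C>_def by simp
    qed
    then obtain n where "W n = V" using from_nat_into_surj[OF C(1)] unfolding W_def by metis
    moreover have "q n x \<le> p n x" for x by (cases n) (auto simp: p)
    ultimately have "{x. p n x < 1} \<subseteq> S"
      using q[of n] V by (auto simp: subset_iff intro: order_le_less_trans)
    then show ?thesis ..
  qed
  ultimately show ?thesis by (rule that)
qed

end

section \<open>Hahn--Banach and uniform boundedness\<close>

text \<open>The operation \<open>opr\<close> is \<open>max\<close> in the ultrametric case and addition over the reals. This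
  intersection property is what the one-dimensional extension step of Hahn--Banach needs, and with
  shrinking radii it also provides completeness.\<close>
definition ball_inter :: "('k::field \<Rightarrow> real) \<Rightarrow> (real \<Rightarrow> real \<Rightarrow> real) \<Rightarrow> bool" where
  "ball_inter b opr \<longleftrightarrow> (\<forall>G :: ('k \<times> real) set.
      (\<forall>(c, r)\<in>G. 0 \<le> r) \<longrightarrow> (\<forall>(c, r)\<in>G. \<forall>(c', r')\<in>G. b (c - c') \<le> opr r r')
      \<longrightarrow> (\<exists>z. \<forall>(c, r)\<in>G. b (c - z) \<le> r))"

lemma ball_interD:
  assumes "ball_inter b opr" "\<And>c r. (c, r) \<in> G \<Longrightarrow> 0 \<le> r"
    "\<And>c r c' r'. (c, r) \<in> G \<Longrightarrow> (c', r') \<in> G \<Longrightarrow> b (c - c') \<le> opr r r'"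
  obtains z where "\<And>c r. (c, r) \<in> G \<Longrightarrow> b (c - z) \<le> r"
proof -
  have "\<exists>z. \<forall>(c, r)\<in>G. b (c - z) \<le> r"
    using assms(1)[unfolded ball_inter_def, rule_format, of G] assms(2,3) by fast
  then show ?thesis using that by blast
qed

text \<open>Serves both kinds of scalars at once: \<open>opr\<close> is \<open>max\<close> or
  addition, and the absolute value \<open>b\<close> may differ from the given one. The seminorm is
  not linked to \<open>T\<close>; where continuity matters, the neighbourhood property of its balls
  is supplied separately.\<close>

locale seminormed = absval_tvs b sm T
  for b :: "'k::field \<Rightarrow> real" and sm :: "'k \<Rightarrow> 'v::ab_group_add \<Rightarrow> 'v" and T +
  fixes s :: "'v \<Rightarrow> real" and opr :: "real \<Rightarrow> real \<Rightarrow> real"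
  assumes ball_inter: "ball_inter b opr"
    and opr_ge: "\<And>x y. 0 \<le> x \<Longrightarrow> 0 \<le> y \<Longrightarrow> max x y \<le> opr x y"
    and s_nonneg [simp]: "\<And>x. 0 \<le> s x"
    and s_scale: "\<And>t x. s (sm t x) = b t * s x"
    and s_add: "\<And>x y. s (x + y) \<le> opr (s x) (s y)"
begin

lemma s_minus [simp]: "s (- x) = s x"
  using s_scale[of "-1" x] by (simp add: sm_minus_left)

text \<open>Partial linear functionals bounded by \<open>s\<close>, stored as graphs so that the
  union of a chain is an upper bound. That they are single-valued is a consequence of the
  domination.\<close>

definition dominated_graph :: "('v \<times> 'k) set \<Rightarrow> bool" where
  "dominated_graph G \<longleftrightarrow> (\<forall>(x, y)\<in>G. b y \<le> s x)
     \<and> (\<forall>(x, y)\<in>G. \<forall>(x', y')\<in>G. (x + x', y + y') \<in> G)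
     \<and> (\<forall>t. \<forall>(x, y)\<in>G. (sm t x, t * y) \<in> G)"

lemma dominated_graphD:
  assumes "dominated_graph G"
  shows "(x, y) \<in> G \<Longrightarrow> b y \<le> s x"
    and "(x, y) \<in> G \<Longrightarrow> (x', y') \<in> G \<Longrightarrow> (x + x', y + y') \<in> G"
    and "(x, y) \<in> G \<Longrightarrow> (sm t x, t * y) \<in> G"
  using assms unfolding dominated_graph_def by blast+

text \<open>Two values over the same point differ by a value over 0, and
  \<open>s 0 = 0\<close>.\<close>

lemma dominated_graph_unique:
  assumes "dominated_graph G" "(x, y) \<in> G" "(x, y') \<in> G" shows "y = y'"
proof -
  have "(x + sm (-1) x, y + (-1) * y') \<in> G"
    using dominated_graphD(2,3)[OF assms(1)] assms(2,3) by blast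
  then have "b (y - y') \<le> s 0"
    using dominated_graphD(1)[OF assms(1)] by (fastforce simp: sm_minus_left)
  also have "s 0 = 0" using s_scale[of 0 0] by simp
  finally show ?thesis using a_eq_0[of "y - y'"] a_nonneg[of "y - y'"] by auto
qed

text \<open>The value \<open>c\<close> at \<open>x\<close> has to lie within
  \<open>s (m - x)\<close> of \<open>y\<close> for every pair \<open>(m, y)\<close> of the graph.
  Any two of these balls are compatible by the triangle inequality for \<open>s\<close>, so
  \<open>ball_inter\<close> yields \<open>c\<close>; homogeneity then extends the bound from
  \<open>m - x\<close> to \<open>m + sm t x\<close>.\<close>

lemma dominated_graph_extend:
  assumes G: "dominated_graph G"
  obtains G' c where "dominated_graph G'" "(x, c) \<in> G'" "G \<subseteq> G'"
proof (cases "G = {}")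
  case True
  have "dominated_graph {(sm t x, 0) | t. True}"
    unfolding dominated_graph_def by (auto simp flip: sm_add_left sm_mult)
  moreover have "(x, 0) \<in> {(sm t x, 0) | t. True}" by (auto intro: exI[of _ 1])
  ultimately show ?thesis using that True by blast
next
  case False
  obtain c where c: "\<And>y r. (y, r) \<in> {(y, s (m - x)) | m y. (m, y) \<in> G} \<Longrightarrow> b (y - c) \<le> r"
  proof (rule ball_interD[OF ball_inter])
    fix y r y' r' assume "(y, r) \<in> {(y, s (m - x)) | m y. (m, y) \<in> G}"
      "(y', r') \<in> {(y, s (m - x)) | m y. (m, y) \<in> G}"
    then obtain m m' where m: "(m, y) \<in> G" "r = s (m - x)" "(m', y') \<in> G" "r' = s (m' - x)" by blast
    have "(m + sm (-1) m', y + (-1) * y') \<in> G"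
      using dominated_graphD(2,3)[OF G] m by blast
    then have "b (y - y') \<le> s (m - m')"
      using dominated_graphD(1)[OF G] by (fastforce simp: sm_minus_left)
    also have "m - m' = (m - x) + - (m' - x)" by simp
    also have "s \<dots> \<le> opr r r'" using s_add[of "m - x" "- (m' - x)"] m by (simp only: s_minus)
    finally show "b (y - y') \<le> opr r r'" .
  qed auto
  define G' where "G' = {(m + sm t x, y + t * c) | m y t. (m, y) \<in> G}"
  have "b (y + t * c) \<le> s (m + sm t x)" if m: "(m, y) \<in> G" for m y t
  proof (cases "t = 0")
    case False
    have "(sm (- inverse t) m, - inverse t * y) \<in> G" using dominated_graphD(3)[OF G m] .
    then have "b (- inverse t * y - c) \<le> s (sm (- inverse t) m - x)" by (intro c) blast
    then have "b (- t) * b (- inverse t * y - c) \<le> b (- t) * s (sm (- inverse t) m - x)"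
      by (rule mult_left_mono) simp
    then have "b (- t * (- inverse t * y - c)) \<le> s (sm (- t) (sm (- inverse t) m - x))"
      by (simp only: a_mult s_scale)
    moreover have "- t * (- inverse t * y - c) = y + t * c" using False by (simp add: algebra_simps)
    moreover have "sm (- t) (sm (- inverse t) m - x) = m + sm t x"
      using False by (simp add: sm_diff sm_minus_left sm_minus sm_inverse)
    ultimately show ?thesis by (simp only:)
  qed (use dominated_graphD(1)[OF G m] in simp)
  then have dom: "\<And>x y. (x, y) \<in> G' \<Longrightarrow> b y \<le> s x" unfolding G'_def by blast
  have add: "(u + u', y + y') \<in> G'" if uy: "(u, y) \<in> G'" "(u', y') \<in> G'" for u y u' y'
  proof -
    obtain m z t where 1: "u = m + sm t x" "y = z + t * c" "(m, z) \<in> G"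
      using uy(1) unfolding G'_def by blast
    obtain m' z' t' where 2: "u' = m' + sm t' x" "y' = z' + t' * c" "(m', z') \<in> G"
      using uy(2) unfolding G'_def by blast
    note * = 1 2
    from * have "(m + m', z + z') \<in> G" using dominated_graphD(2)[OF G] by blast
    moreover have "u + u' = (m + m') + sm (t + t') x" "y + y' = (z + z') + (t + t') * c"
      unfolding * by (simp_all add: sm_add_left algebra_simps)
    ultimately show ?thesis unfolding G'_def by blast
  qed
  have scale: "(sm r u, r * y) \<in> G'" if uy: "(u, y) \<in> G'" for r u y
  proof -
    obtain m z t where *: "u = m + sm t x" "y = z + t * c" "(m, z) \<in> G"
      using uy unfolding G'_def by blast
    then have "(sm r m, r * z) \<in> G" using dominated_graphD(3)[OF G] by blast
    moreover have "sm r u = sm r m + sm (r * t) x" "r * y = r * z + (r * t) * c"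
      unfolding * by (simp_all add: sm_add sm_mult algebra_simps)
    ultimately show ?thesis unfolding G'_def by blast
  qed
  have "dominated_graph G'"
    unfolding dominated_graph_def using dom add scale by blast
  moreover have "G \<subseteq> G'"
  proof
    fix z assume "z \<in> G"
    moreover have "z = (fst z + sm 0 x, snd z + 0 * c)" by simp
    ultimately show "z \<in> G'" unfolding G'_def by (metis (mono_tags, lifting) mem_Collect_eq prod.collapse)
  qed
  moreover have "(x, c) \<in> G'"
  proof -
    obtain m y where "(m, y) \<in> G" using False by auto
    then have "(0, 0) \<in> G" using dominated_graphD(3)[OF G, of m y 0] by simp
    then show ?thesis unfolding G'_def by (force intro: exI[of _ 1])
  qed
  ultimately show ?thesis using that by blast
qed

text \<open>The functional almost attains its bound at \<open>v\<close>. The factor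
  \<open>kap\<close> appears because a scalar of size exactly \<open>s v\<close> need not
  exist.\<close>

lemma Hahn_Banach:
  "\<exists>l. lin_functional sm l \<and> (\<forall>x. b (l x) \<le> s x) \<and> kap * s v \<le> b (l v)"
proof -
  obtain c where c: "kap * s v \<le> b c" "b c \<le> s v"
  proof (cases "s v = 0")
    case True then show ?thesis using that[of 0] by simp
  next
    case False
    then have "s v > 0" using s_nonneg[of v] by linarith
    then obtain t where "t \<noteq> 0" "kap * s v \<le> b t" "b t < s v" by (rule scalar_approx)
    then show ?thesis using that[of t] by simp
  qed
  define \<A> where "\<A> = {G. dominated_graph G \<and> (v, c) \<in> G}"
  have "dominated_graph {(sm t v, t * c) | t. True}"
    unfolding dominated_graph_def using c
    by (auto simp: a_mult s_scale intro!: mult_left_mono simp flip: sm_add_left sm_mult distrib_right mult.assoc)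
  moreover have "(v, c) \<in> {(sm t v, t * c) | t. True}" by (auto intro: exI[of _ 1])
  ultimately have ne: "\<A> \<noteq> {}" unfolding \<A>_def by blast
  have "\<exists>M\<in>\<A>. \<forall>X\<in>\<A>. M \<subseteq> X \<longrightarrow> X = M"
  proof (rule subset_Zorn_nonempty[OF ne])
    fix \<C> assume C: "\<C> \<noteq> {}" "subset.chain \<A> \<C>"
    then have dg: "\<And>G. G \<in> \<C> \<Longrightarrow> dominated_graph G \<and> (v, c) \<in> G"
      unfolding \<A>_def subset.chain_def by blast
    have "(x + x', y + y') \<in> \<Union>\<C>" if "(x, y) \<in> \<Union>\<C>" "(x', y') \<in> \<Union>\<C>" for x y x' y'
    proof -
      obtain G H where G: "G \<in> \<C>" "(x, y) \<in> G" "H \<in> \<C>" "(x', y') \<in> H" using \<open>(x, y) \<in> \<Union>\<C>\<close> \<open>(x', y') \<in> \<Union>\<C>\<close> by blast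
      then have "G \<subseteq> H \<or> H \<subseteq> G" using C(2) unfolding subset.chain_def by blast
      then obtain K where "K \<in> \<C>" "(x, y) \<in> K" "(x', y') \<in> K" using G by blast
      then show ?thesis using dg dominated_graphD(2) by blast
    qed
    moreover have "b y \<le> s x" if "(x, y) \<in> \<Union>\<C>" for x y
      using that dg dominated_graphD(1) by blast
    moreover have "(sm t x, t * y) \<in> \<Union>\<C>" if "(x, y) \<in> \<Union>\<C>" for t x y
      using that dg dominated_graphD(3) by blast
    ultimately have "dominated_graph (\<Union>\<C>)" unfolding dominated_graph_def by blast
    then show "\<Union>\<C> \<in> \<A>" unfolding \<A>_def using dg C(1) by blast
  qed
  then obtain M where M: "dominated_graph M" "(v, c) \<in> M"
    "\<And>X. dominated_graph X \<Longrightarrow> M \<subseteq> X \<Longrightarrow> X = M" unfolding \<A>_def by blast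
  have total: "\<exists>y. (x, y) \<in> M" for x
  proof -
    obtain G' d where "dominated_graph G'" "(x, d) \<in> G'" "M \<subseteq> G'"
      by (rule dominated_graph_extend[OF M(1)])
    then show ?thesis using M(3) by blast
  qed
  define l where "l x = (SOME y. (x, y) \<in> M)" for x
  have l: "(x, l x) \<in> M" for x unfolding l_def by (rule someI_ex[OF total])
  have "l (x + y) = l x + l y" for x y
    using dominated_graph_unique[OF M(1) l] dominated_graphD(2)[OF M(1) l l] by blast
  moreover have "l (sm t x) = t * l x" for t x
    using dominated_graph_unique[OF M(1) l] dominated_graphD(3)[OF M(1) l] by blast
  ultimately have "lin_functional sm l" unfolding lin_functional_def by blast
  moreover have "b (l x) \<le> s x" for x using dominated_graphD(1)[OF M(1) l] .
  moreover have "l v = c" using dominated_graph_unique[OF M(1) l M(2)] .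
  ultimately show ?thesis using c by blast
qed

text \<open>Gliding hump; no Baire category argument is needed.\<close>
lemma uniform_boundedness:
  assumes weak: "\<And>l C. lin_functional sm l \<Longrightarrow> (\<And>x. b (l x) \<le> C * s x) \<Longrightarrow> \<exists>R. \<forall>x\<in>B. b (l x) \<le> R"
  shows "\<exists>R. \<forall>x\<in>B. s x \<le> R"
proof (rule ccontr)
  assume "\<nexists>R. \<forall>x\<in>B. s x \<le> R"
  then have unb: "\<exists>x\<in>B. R < s x" for R by (meson not_le)
  \<comment> \<open>With the ratio \<open>r = b c\<close> below \<open>kap / 8\<close>, the tail
    after the n-th term, at most \<open>2 * r ^ Suc n * s (u n)\<close>, costs at most half of the
    hump \<open>kap / 2 * r ^ n * s (u n)\<close>.\<close>
  obtain c where c: "c \<noteq> 0" "b c < kap / 8" using small[of "kap / 8"] kap by auto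
  define r where "r = b c"
  have r: "0 < r" "r < kap / 8" "r < 1 / 2" unfolding r_def using c a_pos kap by auto
  \<comment> \<open>Chosen so that what remains of the hump,
    \<open>kap / 4 * (r ^ n * s (u n))\<close>, exceeds \<open>n\<close>.\<close>
  have "\<exists>x\<in>B. real n * (4 / kap) / r ^ n < s x" for n using unb .
  then obtain u where u: "\<And>n. u n \<in> B" "\<And>n. real n * (4 / kap) / r ^ n < s (u n)" by metis
  have "\<forall>n. \<exists>l. lin_functional sm l \<and> (\<forall>x. b (l x) \<le> s x) \<and> kap * s (u n) \<le> b (l (u n))"
    using Hahn_Banach by blast
  then obtain l where l: "\<And>n. lin_functional sm (l n)" "\<And>n x. b (l n x) \<le> s x"
    "\<And>n. kap * s (u n) \<le> b (l n (u n))"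
    by (auto dest!: choice)
  \<comment> \<open>The n-th term is added only if the partial sum is still small at
    \<open>u n\<close>. If it is added, the new value is large: the term alone contributes at least
    \<open>kap * r ^ n * s (u n)\<close>, and the old value is less than half of that.\<close>
  define L where "L = rec_nat (\<lambda>_. 0) (\<lambda>n f. if kap / 2 * r ^ n * s (u n) \<le> b (f (u n)) then f
      else (\<lambda>x. f x + c ^ n * l n x))"
  have L0: "L 0 = (\<lambda>_. 0)" unfolding L_def by simp
  have LS: "L (Suc n) = (if kap / 2 * r ^ n * s (u n) \<le> b (L n (u n)) then L n
      else (\<lambda>x. L n x + c ^ n * l n x))" for n unfolding L_def by simp
  have Llin: "lin_functional sm (L n)" for n
  proof (induction n)
    case (Suc n)
    then show ?case using l(1)[of n] unfolding lin_functional_def LS by (auto simp: algebra_simps)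
  qed (simp add: L0 lin_functional_def)
  have term_le: "b (c ^ n * l n x) \<le> r ^ n * s x" for n x
    using l(2)[of n x] r(1) by (simp add: a_mult a_power r_def mult_left_mono)
  have step: "b (L (Suc n) x - L n x) \<le> r ^ n * s x" for n x
    using term_le[of n x] r(1) by (simp add: LS)
  have hump: "kap / 2 * r ^ n * s (u n) \<le> b (L (Suc n) (u n))" for n
  proof (cases "kap / 2 * r ^ n * s (u n) \<le> b (L n (u n))")
    case False
    let ?t = "c ^ n * l n (u n)"
    have "kap * r ^ n * s (u n) \<le> b ?t"
      using mult_left_mono[OF l(3)[of n], of "r ^ n"] r(1) by (simp add: a_mult a_power r_def mult_ac)
    moreover have "b ?t \<le> b (L n (u n) + ?t) + b (L n (u n))"
      using a_add[of "L n (u n) + ?t" "- L n (u n)"] by simp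
    ultimately show ?thesis using False by (simp add: LS)
  qed (simp add: LS)
  \<comment> \<open>The telescoping form of the bound makes the induction close:
    \<open>r < 1 / 2\<close> gives \<open>r ^ m \<le> 2 * (r ^ m - r ^ Suc m)\<close>.\<close>
  have tail: "b (L m x - L n x) \<le> 2 * (r ^ n - r ^ m) * s x" if "n \<le> m" for m n x
    using that
  proof (induction m rule: dec_induct)
    case (step m)
    have "b (L (Suc m) x - L n x) \<le> b (L (Suc m) x - L m x) + b (L m x - L n x)"
      by (rule a_diff_triangle)
    also have "\<dots> \<le> r ^ m * s x + 2 * (r ^ n - r ^ m) * s x"
      using \<open>\<And>n x. b (L (Suc n) x - L n x) \<le> r ^ n * s x\<close>[of m x] step.IH by linarith
    also have "\<dots> = (2 * r ^ n - r ^ m) * s x" by (simp add: algebra_simps)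
    also have "\<dots> \<le> 2 * (r ^ n - r ^ Suc m) * s x"
      using mult_right_mono[of "2 * r" 1 "r ^ m"] r by (intro mult_right_mono) auto
    finally show ?case .
  qed simp
  have tail': "b (L m x - L n x) \<le> 2 * r ^ n * s x" if "n \<le> m" for m n x
  proof -
    have "2 * (r ^ n - r ^ m) * s x \<le> 2 * r ^ n * s x" using r(1) by (intro mult_right_mono) auto
    then show ?thesis using tail[OF that, of x] by linarith
  qed
  \<comment> \<open>The pointwise limit is a common point of the balls around the partial sums.
    Their radii tend to 0, which later forces the limit to be linear.\<close>
  have "\<exists>z. \<forall>n. b (L n x - z) \<le> 2 * r ^ n * s x" for x
  proof -
    obtain z where "\<And>y d. (y, d) \<in> range (\<lambda>n. (L n x, 2 * r ^ n * s x)) \<Longrightarrow> b (y - z) \<le> d"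
    proof (rule ball_interD[OF ball_inter])
      fix y d y' d' assume "(y, d) \<in> range (\<lambda>n. (L n x, 2 * r ^ n * s x))"
        "(y', d') \<in> range (\<lambda>n. (L n x, 2 * r ^ n * s x))"
      then obtain n m where nm: "y = L n x" "d = 2 * r ^ n * s x" "y' = L m x" "d' = 2 * r ^ m * s x" by auto
      then have "0 \<le> d" "0 \<le> d'" using r(1) by auto
      moreover have "b (y - y') \<le> max d d'"
        using tail'[of n m x] tail'[of m n x] nm a_diff_commute[of "L n x" "L m x"]
        by (cases "n \<le> m") auto
      ultimately show "b (y - y') \<le> opr d d'" using opr_ge[of d d'] by linarith
    qed (use r(1) in auto)
    then show ?thesis by blast
  qed
  then obtain \<Lambda> where \<Lambda>: "\<And>x n. b (L n x - \<Lambda> x) \<le> 2 * r ^ n * s x" by metis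
  have r_lim: "(\<lambda>n. r ^ n * K) \<longlonglongrightarrow> 0" for K
    using tendsto_mult_left_zero[OF LIMSEQ_power_zero[of r]] r by simp
  have zeroI: "y = 0" if "\<And>n. b y \<le> r ^ n * K" for y K
  proof -
    have "b y \<le> 0" using LIMSEQ_le_const[OF r_lim[of K]] that by blast
    then show ?thesis using a_nonneg[of y] a_eq_0[of y] by linarith
  qed
  have "\<Lambda> (x + y) - (\<Lambda> x + \<Lambda> y) = 0" for x y
  proof (rule zeroI)
    fix n
    have "\<Lambda> (x + y) - (\<Lambda> x + \<Lambda> y) = - (L n (x + y) - \<Lambda> (x + y)) + ((L n x - \<Lambda> x) + (L n y - \<Lambda> y))"
      using Llin[of n] unfolding lin_functional_def by simp
    also have "b \<dots> \<le> 2 * r ^ n * s (x + y) + (2 * r ^ n * s x + 2 * r ^ n * s y)"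
      by (intro order_trans[OF a_add] add_mono \<Lambda>) (simp only: a_minus \<Lambda>)
    finally show "b (\<Lambda> (x + y) - (\<Lambda> x + \<Lambda> y)) \<le> r ^ n * (2 * (s (x + y) + s x + s y))"
      by (simp add: algebra_simps)
  qed
  moreover have "\<Lambda> (sm t x) - t * \<Lambda> x = 0" for t x
  proof (rule zeroI)
    fix n
    have "\<Lambda> (sm t x) - t * \<Lambda> x = - (L n (sm t x) - \<Lambda> (sm t x)) + t * (L n x - \<Lambda> x)"
      using Llin[of n] unfolding lin_functional_def by (simp add: algebra_simps)
    also have "b \<dots> \<le> 2 * r ^ n * s (sm t x) + b t * (2 * r ^ n * s x)"
      by (intro order_trans[OF a_add] add_mono)
        (simp_all only: a_minus \<Lambda> a_mult mult_left_mono a_nonneg)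
    finally show "b (\<Lambda> (sm t x) - t * \<Lambda> x) \<le> r ^ n * (2 * (s (sm t x) + b t * s x))"
      by (simp add: algebra_simps)
  qed
  ultimately have "lin_functional sm \<Lambda>" unfolding lin_functional_def by simp
  \<comment> \<open>The ball of index 0 is centred at 0, so it gives the domination that makes the
    weak hypothesis applicable to \<Lambda>.\<close>
  moreover have "b (\<Lambda> x) \<le> 2 * s x" for x using \<Lambda>[of 0 x] by (simp add: L0)
  ultimately obtain R where R: "\<And>x. x \<in> B \<Longrightarrow> b (\<Lambda> x) \<le> R" using weak[of \<Lambda> 2] by blast
  have "real n < R" for n
  proof -
    have "b (L (Suc n) (u n)) \<le> b (L (Suc n) (u n) - \<Lambda> (u n)) + b (\<Lambda> (u n))"
      using a_add[of "L (Suc n) (u n) - \<Lambda> (u n)" "\<Lambda> (u n)"] by simp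
    also have "\<dots> \<le> 2 * r ^ Suc n * s (u n) + R" using \<Lambda>[of "Suc n" "u n"] R[OF u(1)[of n]] by linarith
    finally have "(kap / 2 - 2 * r) * (r ^ n * s (u n)) \<le> R" using hump[of n] by (simp add: algebra_simps)
    moreover have "kap / 4 * (r ^ n * s (u n)) \<le> (kap / 2 - 2 * r) * (r ^ n * s (u n))"
      using r by (intro mult_right_mono) auto
    moreover have "real n < kap / 4 * (r ^ n * s (u n))"
      using u(2)[of n] r kap by (simp add: field_simps)
    ultimately show ?thesis by linarith
  qed
  then show False using reals_Archimedean2[of R] by (meson less_asym)
qed

end

section \<open>Intersection properties of balls in the scalar field\<close>

context absval
begin

lemma closedin_ball: "closedin (ktop a) {x. a (c - x) \<le> r}"
  unfolding closedin_def openin_ktop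
proof (intro conjI ballI)
  fix x assume "x \<in> topspace (ktop a) - {x. a (c - x) \<le> r}"
  then have x: "r < a (c - x)" by simp
  have "r < a (c - y)" if "a (y - x) < a (c - x) - r" for y
    using a_diff_triangle[of c x y] that by simp
  then show "\<exists>d>0. \<forall>y. a (y - x) < d \<longrightarrow> y \<in> topspace (ktop a) - {x. a (c - x) \<le> r}"
    using x by (intro exI[of _ "a (c - x) - r"]) (auto simp: not_le)
qed simp

text \<open>Local compactness gives a compact set around some small ball at 0; an affine map with a
  large dilation factor carries it onto a compact set covering the given ball.\<close>

lemma compact_closed_ball:
  assumes "locally_compact_space (ktop a)" shows "compactin (ktop a) {x. a (c - x) \<le> r}"
proof -
  obtain U K where K: "openin (ktop a) U" "compactin (ktop a) K" "0 \<in> U" "U \<subseteq> K"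
    using assms unfolding locally_compact_space_def topspace_ktop by blast
  then obtain d where d: "d > 0" "\<And>y. a (y - 0) < d \<Longrightarrow> y \<in> K" unfolding openin_ktop by blast
  obtain t where t: "t \<noteq> 0" "r / d < a t" using large by blast
  have "continuous_map (ktop a) (ktop a) (\<lambda>x. c + t * x)"
    unfolding continuous_map_ktop
  proof safe
    fix x \<epsilon> assume "\<epsilon> > (0::real)"
    moreover have "a (c + t * y - (c + t * x)) = a t * a (y - x)" for y
      by (simp add: a_mult flip: right_diff_distrib)
    ultimately show "\<exists>O'. openin (ktop a) O' \<and> x \<in> O' \<and> (\<forall>y\<in>O'. a (c + t * y - (c + t * x)) < \<epsilon>)"
      using ball_open[of x "\<epsilon> / a t"] a_pos[OF t(1)]
      by (intro exI[of _ "{y. a (y - x) < \<epsilon> / a t}"]) (auto simp: field_simps)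
  qed
  then have "compactin (ktop a) ((\<lambda>x. c + t * x) ` K)"
    using K(2) image_compactin by blast
  moreover have "{x. a (c - x) \<le> r} \<subseteq> (\<lambda>x. c + t * x) ` K"
  proof
    fix x assume "x \<in> {x. a (c - x) \<le> r}"
    then have "a (x - c) \<le> r" by (simp add: a_diff_commute)
    also have "r < d * a t" using t d by (simp add: field_simps)
    finally have "inverse (a t) * a (x - c) < d"
      using a_pos[OF t(1)] by (simp add: field_simps)
    then have "a (inverse t * (x - c)) < d" using t by (simp only: a_mult a_inverse not_False_eq_True)
    then have "inverse t * (x - c) \<in> K" using d by simp
    then show "x \<in> (\<lambda>x. c + t * x) ` K"
      using t by (intro image_eqI[of _ _ "inverse t * (x - c)"]) (auto simp: field_simps)
  qed
  ultimately show ?thesis using closedin_ball by (rule closed_compactin)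
qed

text \<open>Among finitely many of the balls, the centre of one with smallest radius lies in all of
  them, since the maximum of two radii is then the other radius. Compactness of a single ball passes
  from finite subfamilies to the whole family.\<close>

lemma ball_inter_max:
  assumes lc: "locally_compact_space (ktop a)" shows "ball_inter a max"
  unfolding ball_inter_def
proof (intro allI impI)
  fix G :: "('k \<times> real) set"
  assume nonneg: "\<forall>(c, r)\<in>G. 0 \<le> r"
    and G: "\<forall>(c, r)\<in>G. \<forall>(c', r')\<in>G. a (c - c') \<le> max r r'"
  define C where "C = (\<lambda>(c, r). {x. a (c - x) \<le> r})"
  show "\<exists>z. \<forall>(c, r)\<in>G. a (c - z) \<le> r"
  proof (cases "G = {}")
    case False
    then obtain p0 where p0: "p0 \<in> G" by blast
    have "C p0 \<inter> \<Inter>\<F> \<noteq> {}" if \<F>: "finite \<F>" "\<F> \<subseteq> C ` G" for \<F>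
    proof -
      obtain H where H: "finite H" "H \<subseteq> G" "\<F> = C ` H" using finite_subset_image[OF \<F>] by blast
      define H' where "H' = insert p0 H"
      have H': "finite H'" "H' \<noteq> {}" "H' \<subseteq> G" using H p0 H'_def by auto
      define q where "q = arg_min_on snd H'"
      have q: "q \<in> H'" "\<And>p. p \<in> H' \<Longrightarrow> snd q \<le> snd p"
        unfolding q_def using arg_min_if_finite[OF H'(1,2), of snd] by force+
      have "fst q \<in> C p" if p: "p \<in> H'" for p
      proof -
        have "a (fst p - fst q) \<le> max (snd p) (snd q)" using G H'(3) p q(1) by force
        then show ?thesis using q(2)[OF p] unfolding C_def by (auto simp: case_prod_beta)
      qed
      then show ?thesis unfolding H(3) H'_def by blast
    qed
    moreover have "compactin (ktop a) (C p0)"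
      unfolding C_def using compact_closed_ball[OF lc] by (simp add: case_prod_beta)
    moreover have "\<forall>S\<in>C ` G. closedin (ktop a) S"
      unfolding C_def using closedin_ball by auto
    ultimately have "C p0 \<inter> \<Inter>(C ` G) \<noteq> {}"
      unfolding compactin_fip by blast
    then show ?thesis unfolding C_def by fast
  qed simp
qed

end

text \<open>Helly's theorem for intervals: the supremum of the left endpoints is at most every right
  endpoint.\<close>

lemma ball_inter_real:
  fixes \<phi> :: "'k::field \<Rightarrow> real"
  assumes "surj \<phi>" and diff: "\<And>x y. \<phi> (x - y) = \<phi> x - \<phi> y"
  shows "ball_inter (\<lambda>x. \<bar>\<phi> x\<bar>) (+)"
  unfolding ball_inter_def
proof (intro allI impI)
  fix G :: "('k \<times> real) set"
  assume G: "\<forall>(c, r)\<in>G. \<forall>(c', r')\<in>G. \<bar>\<phi> (c - c')\<bar> \<le> r + r'"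
  show "\<exists>z. \<forall>(c, r)\<in>G. \<bar>\<phi> (c - z)\<bar> \<le> r"
  proof (cases "G = {}")
    case False
    have le: "\<phi> c - r \<le> \<phi> c' + r'" if "(c, r) \<in> G" "(c', r') \<in> G" for c r c' r'
      using G that by (fastforce simp: diff)
    define y where "y = Sup ((\<lambda>(c, r). \<phi> c - r) ` G)"
    obtain z where z: "\<phi> z = y" using assms(1) by (metis surjD)
    have "\<bar>\<phi> (c - z)\<bar> \<le> r" if c: "(c, r) \<in> G" for c r
    proof -
      have "y \<le> \<phi> c + r" unfolding y_def using False le c by (intro cSup_least) auto
      moreover have "\<phi> c - r \<le> y" unfolding y_def
      proof (rule cSup_upper)
        show "bdd_above ((\<lambda>(c, r). \<phi> c - r) ` G)" using le c by (auto intro!: bdd_aboveI[of _ "\<phi> c + r"])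
        show "\<phi> c - r \<in> (\<lambda>(c, r). \<phi> c - r) ` G" using c by force
      qed
      ultimately show ?thesis by (simp add: diff z abs_le_iff)
    qed
    then show ?thesis by blast
  qed simp
qed

context seminormed
begin

lemma continuous_dominated:
  assumes s: "\<And>r. r > 0 \<Longrightarrow> zero_nbhd T {x. s x < r}"
    and l: "lin_functional sm l" "\<And>x. b (l x) \<le> C * s x"
  shows "continuous_map T (ktop b) l"
  unfolding continuous_map_ktop
proof (intro ballI allI impI)
  fix x \<epsilon> assume "\<epsilon> > (0::real)"
  then have "zero_nbhd T {x. s x < \<epsilon> / (\<bar>C\<bar> + 1)}" by (intro s) auto
  then obtain S where S: "openin T S" "x \<in> S" "\<And>y. y \<in> S \<Longrightarrow> y - x \<in> {x. s x < \<epsilon> / (\<bar>C\<bar> + 1)}"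
    by (rule nbhd_translate) blast
  have "b (l y - l x) < \<epsilon>" if "y \<in> S" for y
  proof -
    have "l y = l (y - x) + l x" using l(1) unfolding lin_functional_def by (metis diff_add_cancel)
    then have "b (l y - l x) \<le> C * s (y - x)" using l(2) by simp
    also have "\<dots> \<le> (\<bar>C\<bar> + 1) * s (y - x)" by (intro mult_right_mono) auto
    also have "\<dots> < \<epsilon>" using S(3)[OF that] by (simp add: field_simps)
    finally show ?thesis .
  qed
  then show "\<exists>O'. openin T O' \<and> x \<in> O' \<and> (\<forall>y\<in>O'. b (l y - l x) < \<epsilon>)" using S by blast
qed

end

section \<open>Mackey's theorem on weakly bounded sets\<close>

definition weakly_bounded :: "('k::field \<Rightarrow> real) \<Rightarrow> ('k \<Rightarrow> 'v::ab_group_add \<Rightarrow> 'v) \<Rightarrow> 'v topology \<Rightarrow> 'v set \<Rightarrow> bool" where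
  "weakly_bounded a sm T B \<longleftrightarrow>
     (\<forall>l. lin_functional sm l \<and> continuous_map T (ktop a) l \<longrightarrow> (\<exists>R. \<forall>x\<in>B. a (l x) \<le> R))"

text \<open>Boundedness of scalars depends on the topology alone: one fixed scalar \<open>c\<close>
  shrinks all the values \<open>l x\<close> into an \<open>a\<close>-ball that lies in the unit ball
  of \<open>b\<close>.\<close>

lemma equivalent_absval_bounded:
  assumes "absval a" "absval b" "ktop b = ktop a" and R: "\<forall>x\<in>B. a (l x) \<le> R"
  shows "\<exists>R. \<forall>x\<in>B. b (l x) \<le> R"
proof -
  interpret a: absval a by fact
  interpret b: absval b by fact
  have "zero_nbhd (ktop a) {y. b y < 1}" unfolding assms(3)[symmetric] b.zero_nbhd_ktop by (rule exI[of _ 1]) auto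
  then obtain e where e: "e > 0" "\<And>y. a y < e \<Longrightarrow> b y < 1" unfolding a.zero_nbhd_ktop by blast
  obtain c where c: "c \<noteq> 0" "a c < e / (\<bar>R\<bar> + 1)" using a.small[of "e / (\<bar>R\<bar> + 1)"] e by auto
  have "b (l x) \<le> inverse (b c)" if "x \<in> B" for x
  proof -
    have "a (c * l x) \<le> a c * (\<bar>R\<bar> + 1)" unfolding a.a_mult using R that by (intro mult_left_mono) fastforce+
    also have "\<dots> < e" using c by (simp add: field_simps)
    finally have "b c * b (l x) < 1" using e(2)[of "c * l x"] b.a_mult by simp
    then show ?thesis using b.a_pos[OF c(1)] by (simp add: field_simps)
  qed
  then show ?thesis by blast
qed

text \<open>Uniform boundedness is applied with respect to \<open>b\<close>, while weak boundedness
  and the conclusion are measured by \<open>a\<close>; the common topology translates between the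
  two.\<close>

lemma weakly_bounded_scaled:
  assumes a: "absval a" and S: "seminormed b sm T s opr" and top: "ktop b = ktop a"
    and s: "\<And>r. r > 0 \<Longrightarrow> zero_nbhd T {x. s x < r}" "{x. s x < 1} \<subseteq> W"
    and B: "weakly_bounded a sm T B"
  shows "\<exists>\<delta>>0. \<forall>t x. a t < \<delta> \<longrightarrow> x \<in> B \<longrightarrow> sm t x \<in> W"
proof -
  interpret a: absval a by fact
  interpret seminormed b sm T s opr by fact
  have "\<exists>R. \<forall>x\<in>B. s x \<le> R"
  proof (rule uniform_boundedness)
    fix l C assume l: "lin_functional sm l" "\<And>x. b (l x) \<le> C * s x"
    then have "continuous_map T (ktop a) l" using continuous_dominated[OF s(1), of l C] top by simp
    then show "\<exists>R. \<forall>x\<in>B. b (l x) \<le> R"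
      using B l(1) equivalent_absval_bounded[OF a absval_axioms top] unfolding weakly_bounded_def by blast
  qed
  then obtain R where R: "\<And>x. x \<in> B \<Longrightarrow> s x \<le> R" by blast
  have "zero_nbhd (ktop b) {t. b t < 1 / (\<bar>R\<bar> + 1)}"
    unfolding zero_nbhd_ktop by (intro exI[of _ "1 / (\<bar>R\<bar> + 1)"]) auto
  then obtain \<delta> where d: "\<delta> > 0" "\<And>t. a t < \<delta> \<Longrightarrow> b t < 1 / (\<bar>R\<bar> + 1)"
    unfolding top a.zero_nbhd_ktop by blast
  have "sm t x \<in> W" if "a t < \<delta>" "x \<in> B" for t x
  proof -
    have "b t * s x \<le> b t * (\<bar>R\<bar> + 1)" using R[OF that(2)] by (intro mult_left_mono) auto
    also have "\<dots> < 1" using d(2)[OF that(1)] by (simp add: field_simps)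
    finally show ?thesis using s(2) by (auto simp: s_scale)
  qed
  then show ?thesis using d by blast
qed

text \<open>Condenses the finitely many seminorms of a basic neighbourhood into one, their maximum
  after division by \<epsilon>: it is again ultrametric, and its unit ball lies in that
  neighbourhood.\<close>

lemma seminorms_ultra:
  assumes a: "absval a" and tvs: "tvs a sm T" and lc: "locally_compact_space (ktop a)"
    and P: "\<forall>p\<in>P. ultra_seminorm a sm p" "defined_by_seminorms T P" and W: "zero_nbhd T W"
  shows "\<exists>s. seminormed a sm T s max \<and> (\<forall>r>0. zero_nbhd T {x. s x < r}) \<and> {x. s x < 1} \<subseteq> W"
proof -
  interpret absval a by fact
  interpret absval_tvs a sm T using a tvs by (simp add: absval_tvs_def absval_tvs_axioms_def)
  obtain S where S: "openin T S" "0 \<in> S" "S \<subseteq> W" using W unfolding zero_nbhd_def by blast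
  then obtain Q \<epsilon> where Q: "finite Q" "Q \<subseteq> P" "\<epsilon> > 0" "{y. \<forall>p\<in>Q. p (y - 0) < \<epsilon>} \<subseteq> S"
    using P(2) unfolding defined_by_seminorms_def by meson
  have nbhd: "zero_nbhd T {x. p x < r}" if p: "p \<in> P" and r: "r > 0" for p r
  proof -
    have u: "ultra_seminorm a sm p" using P(1) p by blast
    have p0: "p 0 = 0" using u[unfolded ultra_seminorm_def] by (metis a_0 mult_zero_left sm_0_right)
    have "{y. \<forall>p\<in>{p}. p (y - x) < r} \<subseteq> {x. p x < r}" if x: "p x < r" for x
    proof safe
      fix y assume y: "\<forall>p\<in>{p}. p (y - x) < r"
      have "p ((y - x) + x) \<le> max (p (y - x)) (p x)" using u unfolding ultra_seminorm_def by blast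
      then show "p y < r" using x y by simp
    qed
    then have "\<forall>x\<in>{x. p x < r}. \<exists>Q \<epsilon>. finite Q \<and> Q \<subseteq> P \<and> \<epsilon> > 0 \<and> {y. \<forall>p\<in>Q. p (y - x) < \<epsilon>} \<subseteq> {x. p x < r}"
      using p r by (intro ballI exI[of _ "{p}"] exI[of _ r]) auto
    then have "openin T {x. p x < r}" using P(2) unfolding defined_by_seminorms_def by blast
    then show ?thesis unfolding zero_nbhd_def using p0 r by (intro exI[of _ "{x. p x < r}"]) auto
  qed
  have "\<exists>s. ultra_seminorm a sm s \<and> (\<forall>r>0. zero_nbhd T {x. s x < r}) \<and> (\<forall>x. s x < 1 \<longrightarrow> (\<forall>p\<in>Q. p x < \<epsilon>))"
    using Q(1,2)
  proof (induction Q)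
    case empty
    show ?case
      by (rule exI[of _ "\<lambda>_. 0"]) (auto simp: ultra_seminorm_def zero_nbhd_def intro: exI[of _ UNIV]
          openin_topspace[of T, unfolded topspace_T])
  next
    case (insert p Q)
    then obtain s where s: "ultra_seminorm a sm s" "\<forall>r>0. zero_nbhd T {x. s x < r}"
      "\<forall>x. s x < 1 \<longrightarrow> (\<forall>p\<in>Q. p x < \<epsilon>)" by auto
    have p: "ultra_seminorm a sm p" "p \<in> P" using P(1) insert.prems by auto
    define s' where "s' x = max (s x) (p x / \<epsilon>)" for x
    have "0 \<le> s' x" for x using s(1) unfolding s'_def ultra_seminorm_def by (simp add: le_max_iff_disj)
    moreover have "s' (sm t x) = a t * s' x" for t x
      using s(1) p(1) max_mult_distrib_left[of "a t" "s x" "p x / \<epsilon>"]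
      unfolding s'_def ultra_seminorm_def by simp
    moreover have "s' (x + y) \<le> max (s' x) (s' y)" for x y
    proof -
      have "s (x + y) \<le> max (s x) (s y)" using s(1) unfolding ultra_seminorm_def by blast
      moreover have "p (x + y) \<le> max (p x) (p y)" using p(1) unfolding ultra_seminorm_def by blast
      then have "p (x + y) / \<epsilon> \<le> max (p x / \<epsilon>) (p y / \<epsilon>)"
        using Q(3) by (auto simp: le_max_iff_disj divide_right_mono)
      ultimately show ?thesis unfolding s'_def by linarith
    qed
    ultimately have "ultra_seminorm a sm s'" unfolding ultra_seminorm_def by blast
    moreover have "zero_nbhd T {x. s' x < r}" if r: "r > 0" for r
    proof -
      have "{x. s' x < r} = {x. s x < r} \<inter> {x. p x < r * \<epsilon>}"
        unfolding s'_def using Q(3) by (auto simp: field_simps)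
      then show ?thesis
        using zero_nbhd_Int[of T "{x. s x < r}" "{x. p x < r * \<epsilon>}"] s(2) nbhd[OF p(2)] Q(3) r by simp
    qed
    moreover have "s' x < 1 \<longrightarrow> (\<forall>p\<in>insert p Q. p x < \<epsilon>)" for x
      using s(3) Q(3) unfolding s'_def by (auto simp: field_simps)
    ultimately show ?case by blast
  qed
  then obtain s where s: "ultra_seminorm a sm s" "\<forall>r>0. zero_nbhd T {x. s x < r}"
    "\<forall>x. s x < 1 \<longrightarrow> (\<forall>p\<in>Q. p x < \<epsilon>)" by blast
  have "seminormed a sm T s max"
    by unfold_locales (use s(1) ball_inter_max[OF lc] in \<open>auto simp: ultra_seminorm_def\<close>)
  moreover have "{x. s x < 1} \<subseteq> {y. \<forall>p\<in>Q. p (y - 0) < \<epsilon>}" using s(3) by auto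
  then have "{x. s x < 1} \<subseteq> W" using Q(4) S(3) by (meson order_trans)
  ultimately show ?thesis using s(2) by blast
qed

text \<open>The absolute value \<open>a\<close> may be a proper power of the usual one, so seminorms are taken with
  respect to another absolute value \<open>b\<close> defining the same topology.\<close>
lemma seminorms_real:
  fixes a :: "'k::field \<Rightarrow> real" and sm :: "'k \<Rightarrow> 'v::ab_group_add \<Rightarrow> 'v"
  assumes a: "absval a" and tvs: "tvs a sm T" and real: "is_real_field a"
    and lc: "\<forall>W. zero_nbhd T W \<longrightarrow> (\<exists>A. zero_nbhd T A \<and> A \<subseteq> W \<and> convex_K sm A)"
    and W: "zero_nbhd T W"
  shows "\<exists>b s. seminormed b sm T s (+) \<and> ktop b = ktop a \<and>
    (\<forall>r>0. zero_nbhd T {x. s x < r}) \<and> {x. s x < 1} \<subseteq> W"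
proof -
  interpret a: absval a by fact
  obtain \<phi> :: "'k \<Rightarrow> real" where \<phi>: "bij \<phi>" "\<And>x y. \<phi> (x + y) = \<phi> x + \<phi> y"
      "\<And>x y. \<phi> (x * y) = \<phi> x * \<phi> y" "\<phi> 1 = 1" and hom: "homeomorphic_map (ktop a) euclideanreal \<phi>"
    using real unfolding is_real_field_def by blast
  have \<phi>0: "\<phi> 0 = 0" using \<phi>(2)[of 0 0] by simp
  have \<phi>_minus: "\<phi> (- x) = - \<phi> x" for x using \<phi>(2)[of x "- x"] \<phi>0 by simp
  have \<phi>_diff: "\<phi> (x - y) = \<phi> x - \<phi> y" for x y using \<phi>(2)[of x "- y"] \<phi>_minus by simp
  have inj: "inj \<phi>" and surj: "surj \<phi>" using \<phi>(1) by (simp_all add: bij_is_inj bij_is_surj)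
  have \<phi>_eq0: "\<phi> x = 0 \<longleftrightarrow> x = 0" for x using inj \<phi>0 by (metis injD)
  define b where "b x = \<bar>\<phi> x\<bar>" for x
  have b: "absval b"
  proof
    show "abs_value b" unfolding abs_value_def b_def
      by (auto simp: \<phi>_eq0 \<phi>(2,3) abs_mult)
    fix r :: real assume "r > 0"
    obtain t where "\<phi> t = r / 2" using surj by (metis surjD)
    then show "\<exists>t. t \<noteq> 0 \<and> b t < r" using \<open>r > 0\<close> \<phi>0 unfolding b_def by (intro exI[of _ t]) auto
  qed
  interpret b: absval b by (rule b)
  have top: "ktop b = ktop a"
    unfolding topology_eq
  proof
    fix S
    have "openin (ktop a) S \<longleftrightarrow> open (\<phi> ` S)"
      using homeomorphic_map_openness[OF hom, of S] by simp
    also have "\<dots> \<longleftrightarrow> openin (ktop b) S"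
      unfolding b.openin_ktop open_dist ball_simps
    proof (intro ball_cong refl ex_cong1 conj_cong)
      fix x e
      have "(\<forall>y. dist y (\<phi> x) < e \<longrightarrow> y \<in> \<phi> ` S) \<longleftrightarrow> (\<forall>z. dist (\<phi> z) (\<phi> x) < e \<longrightarrow> \<phi> z \<in> \<phi> ` S)"
        using surj by (metis surjD)
      then show "(\<forall>y. dist y (\<phi> x) < e \<longrightarrow> y \<in> \<phi> ` S) \<longleftrightarrow> (\<forall>y. b (y - x) < e \<longrightarrow> y \<in> S)"
        unfolding b_def by (simp add: dist_real_def \<phi>_diff inj_image_mem_iff[OF inj])
    qed
    finally show "openin (ktop b) S = openin (ktop a) S" by simp
  qed
  interpret bt: absval_tvs b sm T
    by unfold_locales (use tvs top in \<open>simp add: tvs_def\<close>)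
  obtain A where A: "zero_nbhd T A" "A \<subseteq> W" "convex_K sm A" using lc W by blast
  \<comment> \<open>\<open>convex_K\<close> admits the weights \<open>s\<close> for which
    \<open>s\<close> and \<open>1 - s\<close> are squares; over the reals these are the weights in
    [0,1].\<close>
  have square: "\<exists>c. s = c * c" if "0 \<le> \<phi> s" for s
  proof -
    obtain c where "\<phi> c = sqrt (\<phi> s)" using surj by (metis surjD)
    then have "\<phi> (c * c) = \<phi> s" using that by (simp add: \<phi>(3))
    then show ?thesis using inj by (metis injD)
  qed
  have conv: "sm s x + sm (1 - s) y \<in> A" if "x \<in> A" "y \<in> A" "0 \<le> \<phi> s" "\<phi> s \<le> 1" for s x y
    using A(3) that square[of s] square[of "1 - s"] unfolding convex_K_def by (simp add: \<phi>_diff \<phi>(4))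
  \<comment> \<open>A symmetric convex set containing 0 is balanced over the reals, so its Minkowski
    functional is available.\<close>
  define V where "V = A \<inter> {x. - x \<in> A}"
  have "zero_nbhd T {x. - x \<in> A}" using bt.zero_nbhd_scale[OF A(1), of "-1"] by (simp add: bt.sm_minus_left)
  then have V: "zero_nbhd T V" unfolding V_def using zero_nbhd_Int A(1) by blast
  have Vconv: "sm s x + sm (1 - s) y \<in> V" if "x \<in> V" "y \<in> V" "0 \<le> \<phi> s" "\<phi> s \<le> 1" for s x y
    using conv[of x y s] conv[of "- x" "- y" s] that unfolding V_def by (simp add: bt.sm_minus)
  have bal: "sm t x \<in> V" if t: "b t \<le> 1" and x: "x \<in> V" for t x
  proof (cases "0 \<le> \<phi> t")
    case True
    then show ?thesis using Vconv[OF x zero_nbhd_0[OF V], of t] t unfolding b_def by simp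
  next
    case False
    have "- x \<in> V" using x unfolding V_def by simp
    then show ?thesis using Vconv[OF _ zero_nbhd_0[OF V], of "- x" "- t"] t False
      unfolding b_def by (simp add: bt.sm_minus bt.sm_minus_left \<phi>_minus)
  qed
  let ?s = "bt.mink V"
  note mink = bt.mink_nonneg[OF V bal] bt.mink_scale[OF V bal] bt.mink_nbhd[OF V bal]
    bt.mink_sub_one[OF V bal] bt.mink_less[OF V bal]
  \<comment> \<open>The infimum in \<open>mink\<close> ranges over scalars of either sign;
    balancedness lets any positive scalar of larger size take the place of a witness.\<close>
  have gt: "sm (inverse \<tau>) x \<in> V" if less: "?s x < \<phi> \<tau>" for x \<tau>
  proof -
    obtain t where t: "t \<noteq> 0" "sm (inverse t) x \<in> V" "b t < \<phi> \<tau>" using less mink(5) by blast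
    then have pos: "0 < \<phi> \<tau>" using b.a_nonneg[of t] by linarith
    then have "\<tau> \<noteq> 0" using \<phi>0 by auto
    moreover have "b \<tau> = \<phi> \<tau>" using pos by (simp add: b_def)
    ultimately have "b (inverse \<tau> * t) = b t / \<phi> \<tau>"
      by (simp add: b.a_mult b.a_inverse divide_inverse mult.commute)
    then have "b (inverse \<tau> * t) \<le> 1" using t(3) pos by simp
    then have "sm (inverse \<tau> * t) (sm (inverse t) x) \<in> V" by (rule bal) (rule t)
    then show ?thesis using t by (simp add: bt.sm_mult bt.sm_inverse)
  qed
  have sub: "?s (x + y) \<le> ?s x + ?s y" for x y
  proof (rule field_le_epsilon)
    fix e :: real assume e: "e > 0"
    obtain \<tau> where \<tau>: "\<phi> \<tau> = ?s x + e / 2" using surj by (metis surjD)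
    obtain \<tau>' where \<tau>': "\<phi> \<tau>' = ?s y + e / 2" using surj by (metis surjD)
    have pos: "\<phi> \<tau> > 0" "\<phi> \<tau>' > 0" using \<tau> \<tau>' e mink(1) by (simp_all add: add_nonneg_pos)
    then have nz: "\<tau> \<noteq> 0" "\<tau>' \<noteq> 0" "\<tau> + \<tau>' \<noteq> 0" using \<phi>(2)[of \<tau> \<tau>'] \<phi>0 by auto
    \<comment> \<open>The vector x + y divided by \<tau> + \<tau>' is the convex combination of x /
      \<tau> and y / \<tau>' with weight \<rho> on the first.\<close>
    define \<rho> where "\<rho> = \<tau> * inverse (\<tau> + \<tau>')"
    have \<rho>: "1 - \<rho> = \<tau>' * inverse (\<tau> + \<tau>')" unfolding \<rho>_def using nz(3) by (simp add: field_simps)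
    have "\<rho> * (\<tau> + \<tau>') = \<tau>" using nz(3) unfolding \<rho>_def by (simp add: mult.assoc)
    then have "\<phi> \<rho> * \<phi> (\<tau> + \<tau>') = \<phi> \<tau>" by (simp only: flip: \<phi>(3))
    then have \<rho>_eq: "\<phi> \<rho> = \<phi> \<tau> / (\<phi> \<tau> + \<phi> \<tau>')" using pos \<phi>(2)[of \<tau> \<tau>'] by (simp add: field_simps)
    have "0 \<le> \<phi> \<rho>" "\<phi> \<rho> \<le> 1" unfolding \<rho>_eq using pos by simp_all
    then have "sm \<rho> (sm (inverse \<tau>) x) + sm (1 - \<rho>) (sm (inverse \<tau>') y) \<in> V"
      using gt \<tau> \<tau>' e by (intro Vconv) auto
    moreover have "\<rho> * inverse \<tau> = inverse (\<tau> + \<tau>')" "(1 - \<rho>) * inverse \<tau>' = inverse (\<tau> + \<tau>')"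
      unfolding \<rho> using nz by (simp_all add: \<rho>_def)
    ultimately have "sm (inverse (\<tau> + \<tau>')) (x + y) \<in> V"
      by (simp add: bt.sm_add flip: bt.sm_mult)
    then have "?s (x + y) \<le> b (\<tau> + \<tau>')" using bt.mink_le[OF nz(3)] by blast
    also have "\<dots> = ?s x + ?s y + e" using pos \<tau> \<tau>' by (simp add: b_def \<phi>(2))
    finally show "?s (x + y) \<le> ?s x + ?s y + e" .
  qed
  have "b = (\<lambda>x. \<bar>\<phi> x\<bar>)" by (simp add: b_def fun_eq_iff)
  then have "ball_inter b (+)" using ball_inter_real[OF surj \<phi>_diff] by simp
  then have "seminormed b sm T ?s (+)"
    by unfold_locales (use mink(1,2) sub in auto)
  moreover have "{x. ?s x < 1} \<subseteq> W" using mink(4) A(2) V_def by blast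
  ultimately show ?thesis using mink(3) top by blast
qed

text \<open>One seminorm suffices for each \<open>W\<close>: its unit ball lies in \<open>W\<close>,
  and \<open>B\<close> is bounded for it by uniform boundedness. The case distinction selects the
  matching notion of local convexity, with \<open>max\<close> or addition as
  \<open>opr\<close>.\<close>

theorem weakly_bounded_imp_bounded:
  assumes lcf: "locally_compact_field a" and field: "is_real_field a \<or> totally_disconnected_top (ktop a)"
    and tvs: "tvs a sm T" and lc: "locally_convex a sm T"
    and B: "weakly_bounded a sm T B" and W: "zero_nbhd T W"
  obtains \<delta> where "\<delta> > 0" "\<And>t x. a t < \<delta> \<Longrightarrow> x \<in> B \<Longrightarrow> sm t x \<in> W"
proof -
  have a: "absval a" using locally_compact_field_absval[OF lcf] .
  have "\<exists>\<delta>>0. \<forall>t x. a t < \<delta> \<longrightarrow> x \<in> B \<longrightarrow> sm t x \<in> W"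
  proof (cases "totally_disconnected_top (ktop a)")
    case True
    then obtain P where P: "\<forall>p\<in>P. ultra_seminorm a sm p" "defined_by_seminorms T P"
      using lc unfolding locally_convex_def by auto
    have "locally_compact_space (ktop a)" using lcf unfolding locally_compact_field_def by blast
    then obtain s where "seminormed a sm T s max" "\<forall>r>0. zero_nbhd T {x. s x < r}" "{x. s x < 1} \<subseteq> W"
      using seminorms_ultra[OF a tvs _ P W] by blast
    then show ?thesis by (intro weakly_bounded_scaled[OF a _ refl _ _ B, where s = s and opr = max]) auto
  next
    case False
    then have "is_real_field a" "\<forall>W. zero_nbhd T W \<longrightarrow> (\<exists>A. zero_nbhd T A \<and> A \<subseteq> W \<and> convex_K sm A)"
      using field lc unfolding locally_convex_def by auto
    then obtain b s where "seminormed b sm T s (+)" "ktop b = ktop a"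
      "\<forall>r>0. zero_nbhd T {x. s x < r}" "{x. s x < 1} \<subseteq> W"
      using seminorms_real[OF a tvs _ _ W] by blast
    then show ?thesis by (intro weakly_bounded_scaled[OF a _ _ _ _ B, where b = b and s = s and opr = "(+)"]) auto
  qed
  then show ?thesis using that by blast
qed

section \<open>Gauges on the spaces of trees\<close>

lemma psub_lev: "x \<in> lev j \<Longrightarrow> y \<in> lev j \<Longrightarrow> psub x y \<in> lev j"
  by (induction j arbitrary: x y) auto

lemma psmul_lev: "x \<in> lev j \<Longrightarrow> psmul sm t x \<in> lev j"
  by (induction j arbitrary: x) auto

lemma pzero_lev: "pzero j \<in> lev j"
  by (induction j) auto

lemma psub_pzero: "x \<in> lev j \<Longrightarrow> psub x (pzero j) = (x :: ('e::ab_group_add, 'k::field) bpt)"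
  by (induction j arbitrary: x) auto

lemma pdom_subset_lev: "pdom sm U j \<subseteq> lev j"
  by (induction j) auto

text \<open>Both clauses of \<open>ptop\<close> call a set of trees open if its preimage under a
  constructor is open. Openness can be unfolded only once such a family is known to be a
  topology.\<close>

lemma istopology_pullback: "istopology (\<lambda>S. S \<subseteq> A \<and> openin X {z \<in> D. f z \<in> S})"
  unfolding istopology_def
proof (intro conjI allI impI)
  fix S S' assume "S \<subseteq> A \<and> openin X {z \<in> D. f z \<in> S}" "S' \<subseteq> A \<and> openin X {z \<in> D. f z \<in> S'}"
  moreover have "{z \<in> D. f z \<in> S \<inter> S'} = {z \<in> D. f z \<in> S} \<inter> {z \<in> D. f z \<in> S'}" by blast
  ultimately show "S \<inter> S' \<subseteq> A" "openin X {z \<in> D. f z \<in> S \<inter> S'}" by auto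
next
  fix \<K> assume "\<forall>K\<in>\<K>. K \<subseteq> A \<and> openin X {z \<in> D. f z \<in> K}"
  moreover have "{z \<in> D. f z \<in> \<Union>\<K>} = \<Union>((\<lambda>K. {z \<in> D. f z \<in> K}) ` \<K>)" by blast
  ultimately show "\<Union>\<K> \<subseteq> A" "openin X {z \<in> D. f z \<in> \<Union>\<K>}" by auto
qed

lemma openin_ptop_0:
  "openin (ptop a T 0) S \<longleftrightarrow> S \<subseteq> range BLeaf \<and> openin T (BLeaf -` S)"
proof -
  have ist: "istopology (\<lambda>S. S \<subseteq> range BLeaf \<and> openin T (BLeaf -` S))"
    using istopology_pullback[of "range BLeaf" T UNIV BLeaf] by (simp add: vimage_def)
  show ?thesis unfolding ptop.simps topology_inverse'[OF ist] by (rule refl)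
qed

lemma openin_ptop_Suc:
  fixes a :: "'k::field \<Rightarrow> real" and S :: "('e, 'k) bpt set"
  shows "openin (ptop a T (Suc n)) S \<longleftrightarrow> S \<subseteq> lev (Suc n) \<and>
     openin (prod_topology (ptop a T n) (prod_topology (ptop a T n) (ktop a)))
       {(p, q, t). p \<in> lev n \<and> q \<in> lev n \<and> BNode p q t \<in> S}"
proof -
  have eq: "{z \<in> lev n \<times> lev n \<times> UNIV. (case z of (p, q, t) \<Rightarrow> BNode p q t) \<in> S} =
      {(p, q, t). p \<in> lev n \<and> q \<in> lev n \<and> BNode p q t \<in> S}" for S :: "('e, 'k) bpt set" by auto
  have ist: "istopology (\<lambda>S :: ('e, 'k) bpt set. S \<subseteq> lev (Suc n) \<and>
     openin (prod_topology (ptop a T n) (prod_topology (ptop a T n) (ktop a)))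
       {(p, q, t). p \<in> lev n \<and> q \<in> lev n \<and> BNode p q t \<in> S})"
    unfolding eq[symmetric] by (rule istopology_pullback)
  show ?thesis unfolding ptop.simps topology_inverse'[OF ist] by (rule refl)
qed

text \<open>The product gauge on the iterated space E^[j] generated by a single gauge on
  \<open>E\<close>: the maximum over all vectors and scalars in the tree.\<close>

primrec tree_gauge :: "('k \<Rightarrow> real) \<Rightarrow> ('e \<Rightarrow> real) \<Rightarrow> ('e, 'k) bpt \<Rightarrow> real" where
  "tree_gauge a p (BLeaf x) = p x"
| "tree_gauge a p (BNode x y t) = max (max (tree_gauge a p x) (tree_gauge a p y)) (a t)"

lemma gaugeD:
  assumes "gauge a sm T p"
  shows "0 \<le> p x" "p (sm t x) = a t * p x" "r > 0 \<Longrightarrow> zero_nbhd T {x. p x < r}"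
  using assms unfolding gauge_def by auto

lemma tree_gauge_mono: "(\<And>x. p x \<le> p' x) \<Longrightarrow> tree_gauge a p x \<le> tree_gauge a p' x"
  by (induction x) (auto simp: le_max_iff_disj)

context absval_tvs
begin

lemma topspace_ptop [simp]: "topspace (ptop a T n) = lev n"
proof (induction n)
  case 0
  have "openin (ptop a T 0) (lev 0)"
    using openin_topspace[of T] by (simp add: openin_ptop_0 vimage_def del: ptop.simps)
  then show ?case unfolding topspace_def using openin_ptop_0[of a T] by (auto simp del: ptop.simps)
next
  case (Suc n)
  have eq: "{(p, q, t). p \<in> lev n \<and> q \<in> lev n \<and> BNode p q t \<in> lev (Suc n)} =
      topspace (prod_topology (ptop a T n) (prod_topology (ptop a T n) (ktop a)))"
    using Suc by (auto simp del: ptop.simps)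
  then have "openin (ptop a T (Suc n)) (lev (Suc n))"
    unfolding openin_ptop_Suc by (intro conjI subset_refl) (simp only: eq openin_topspace)
  moreover have "S \<subseteq> lev (Suc n)" if "openin (ptop a T (Suc n)) S" for S
    using that unfolding openin_ptop_Suc by blast
  ultimately show ?case unfolding topspace_def by blast
qed

lemma tree_gauge_nonneg: "gauge a sm T p \<Longrightarrow> 0 \<le> tree_gauge a p x"
  by (induction x) (auto simp: gaugeD le_max_iff_disj)

lemma tree_gauge_psmul: "gauge a sm T p \<Longrightarrow> tree_gauge a p (psmul sm t x) = a t * tree_gauge a p x"
  by (induction x) (auto simp: gaugeD(2) a_mult max_mult_distrib_left)

lemma tree_gauge_nbhd:
  assumes p: "gauge a sm T p" and x0: "x0 \<in> lev j" and r: "r > 0"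
  shows "\<exists>S. openin (ptop a T j) S \<and> x0 \<in> S \<and> (\<forall>y\<in>S. y \<in> lev j \<and> tree_gauge a p (psub y x0) < r)"
  using x0
proof (induction j arbitrary: x0)
  case 0
  then obtain u where u: "x0 = BLeaf u" by auto
  obtain S where S: "openin T S" "u \<in> S" "\<And>y. y \<in> S \<Longrightarrow> y - u \<in> {x. p x < r}"
    by (rule nbhd_translate[OF gaugeD(3)[OF p r], of u]) blast
  have "BLeaf -` (BLeaf ` S :: ('v, 'k) bpt set) = S" by auto
  then have "openin (ptop a T 0) (BLeaf ` S)" unfolding openin_ptop_0 using S(1) by (simp add: image_subset_iff)
  then show ?case using S u by (intro exI[of _ "BLeaf ` S"]) auto
next
  case (Suc n)
  then obtain u v t where x0: "x0 = BNode u v t" "u \<in> lev n" "v \<in> lev n" by auto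
  obtain S where S: "openin (ptop a T n) S" "u \<in> S" "\<forall>y\<in>S. y \<in> lev n \<and> tree_gauge a p (psub y u) < r"
    using Suc.IH[OF x0(2)] by blast
  obtain S' where S': "openin (ptop a T n) S'" "v \<in> S'" "\<forall>y\<in>S'. y \<in> lev n \<and> tree_gauge a p (psub y v) < r"
    using Suc.IH[OF x0(3)] by blast
  define O' where "O' = {BNode y z s | y z s. y \<in> S \<and> z \<in> S' \<and> a (s - t) < r}"
  have "{(y, z, s). y \<in> lev n \<and> z \<in> lev n \<and> BNode y z s \<in> O'} = S \<times> S' \<times> {s. a (s - t) < r}"
    unfolding O'_def using S(3) S'(3) by auto
  then have "openin (ptop a T (Suc n)) O'"
    unfolding openin_ptop_Suc using S S' ball_open
    by (auto simp: openin_prod_Times_iff O'_def simp del: ptop.simps)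
  moreover have "x0 \<in> O'" unfolding O'_def x0(1) using S S' r by auto
  moreover have "\<forall>y\<in>O'. y \<in> lev (Suc n) \<and> tree_gauge a p (psub y x0) < r"
    unfolding O'_def x0(1) using S(3) S'(3) by auto
  ultimately show ?case by blast
qed

lemma pgauge_scaled_tree_gauge:
  assumes p: "gauge a sm T p" and c: "c > 0" shows "pgauge a sm T j (\<lambda>x. c * tree_gauge a p x)"
  unfolding pgauge_def
proof (intro conjI ballI allI impI)
  fix r :: real assume "r > 0"
  then have "r / c > 0" using c by simp
  then obtain S where S: "openin (ptop a T j) S" "pzero j \<in> S"
    "\<forall>y\<in>S. y \<in> lev j \<and> tree_gauge a p (psub y (pzero j)) < r / c"
    using tree_gauge_nbhd[OF p pzero_lev] by blast
  have "S \<subseteq> {x \<in> lev j. c * tree_gauge a p x < r}"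
    using S(3) c by (auto simp: psub_pzero field_simps)
  then show "\<exists>Ov. openin (ptop a T j) Ov \<and> pzero j \<in> Ov \<and> Ov \<subseteq> {x \<in> lev j. c * tree_gauge a p x < r}"
    using S by blast
qed (use c in \<open>auto simp: tree_gauge_nonneg[OF p] tree_gauge_psmul[OF p]\<close>)

end

section \<open>Countably many gauges control the iterated spaces\<close>

locale gauge_base = absval_tvs a sm T
  for a :: "'k::field \<Rightarrow> real" and sm :: "'k \<Rightarrow> 'v::ab_group_add \<Rightarrow> 'v" and T +
  fixes p :: "nat \<Rightarrow> 'v \<Rightarrow> real"
  assumes p_gauge: "\<And>n. gauge a sm T (p n)"
    and p_mono: "\<And>m n x. m \<le> n \<Longrightarrow> p m x \<le> p n x"
    and p_base: "\<And>W. zero_nbhd T W \<Longrightarrow> \<exists>n. {x. p n x < 1} \<subseteq> W"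
begin

text \<open>The radius shrinks with \<open>n\<close> although the unit balls of the
  \<open>p n\<close> already form a base: the scalar entries of a tree are measured by
  \<open>a\<close> for every \<open>n\<close>, so only smaller radii bring them close.\<close>

abbreviation "near n x0 x \<equiv> tree_gauge a (p n) (psub x x0) < 1 / (real n + 1)"

lemma near_mono: assumes "near n x0 x" "m \<le> n" shows "near m x0 x"
proof -
  have "tree_gauge a (p m) (psub x x0) \<le> tree_gauge a (p n) (psub x x0)"
    using assms(2) by (intro tree_gauge_mono p_mono)
  also have "\<dots> < 1 / (real n + 1)" by fact
  also have "\<dots> \<le> 1 / (real m + 1)" using assms(2) by (intro divide_left_mono) auto
  finally show ?thesis .
qed

lemma tree_gauge_base:
  assumes "openin (ptop a T j) S" "x0 \<in> S"
  shows "\<exists>n. \<forall>y\<in>lev j. near n x0 y \<longrightarrow> y \<in> S"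
  using assms
proof (induction j arbitrary: S x0)
  case 0
  then obtain u where u: "x0 = BLeaf u" and S: "openin T (BLeaf -` S)" unfolding openin_ptop_0 by auto
  obtain n where n: "{x. p n x < 1} \<subseteq> {y. u + y \<in> BLeaf -` S}"
    using p_base[OF zero_nbhd_translate[OF S, of u]] 0 u by auto
  have "y \<in> S" if y: "y \<in> lev 0" "near n x0 y" for y
  proof -
    obtain v where v: "y = BLeaf v" using y(1) by auto
    have "p n (v - u) < 1 / (real n + 1)" using y(2) v u by simp
    also have "\<dots> \<le> 1" by simp
    finally have "v - u \<in> {y. u + y \<in> BLeaf -` S}" using n by blast
    then show ?thesis using v by simp
  qed
  then show ?case by blast
next
  case (Suc j)
  then have S: "S \<subseteq> lev (Suc j)" "openin (prod_topology (ptop a T j) (prod_topology (ptop a T j) (ktop a)))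
      {(p, q, t). p \<in> lev j \<and> q \<in> lev j \<and> BNode p q t \<in> S}"
    unfolding openin_ptop_Suc by auto
  then obtain u v t where x0: "x0 = BNode u v t" "u \<in> lev j" "v \<in> lev j" using Suc.prems by auto
  then have "(u, v, t) \<in> {(p, q, t). p \<in> lev j \<and> q \<in> lev j \<and> BNode p q t \<in> S}" using Suc.prems by simp
  then obtain A B where A: "openin (ptop a T j) A" "u \<in> A"
    "openin (prod_topology (ptop a T j) (ktop a)) B" "(v, t) \<in> B"
    "A \<times> B \<subseteq> {(p, q, t). p \<in> lev j \<and> q \<in> lev j \<and> BNode p q t \<in> S}"
    by (rule openin_prodE[OF S(2)])
  obtain C R where C: "openin (ptop a T j) C" "v \<in> C" "openin (ktop a) R" "t \<in> R" "C \<times> R \<subseteq> B"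
    by (rule openin_prodE[OF A(3,4)])
  obtain n1 where n1: "\<forall>y\<in>lev j. near n1 u y \<longrightarrow> y \<in> A" using Suc.IH[OF A(1,2)] by blast
  obtain n2 where n2: "\<forall>y\<in>lev j. near n2 v y \<longrightarrow> y \<in> C" using Suc.IH[OF C(1,2)] by blast
  obtain r where r: "r > 0" "\<And>s. a (s - t) < r \<Longrightarrow> s \<in> R" using C(3,4) unfolding openin_ktop by blast
  obtain n3 where n3: "1 / (real n3 + 1) < r" using reals_Archimedean[OF r(1)] by (auto simp: inverse_eq_divide add.commute)
  define n where "n = max n1 (max n2 n3)"
  have n: "n1 \<le> n" "n2 \<le> n" "n3 \<le> n" unfolding n_def by auto
  have "y \<in> S" if y': "y \<in> lev (Suc j)" "near n x0 y" for y
  proof -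
    obtain u' v' t' where y: "y = BNode u' v' t'" "u' \<in> lev j" "v' \<in> lev j" using y'(1) by auto
    have "near n u u'" "near n v v'" "a (t' - t) < 1 / (real n + 1)" using y'(2) y x0 by auto
    moreover have "1 / (real n + 1) \<le> 1 / (real n3 + 1)" using n(3) by (intro divide_left_mono) auto
    ultimately have "near n1 u u'" "near n2 v v'" "a (t' - t) < r" using near_mono n n3 by (blast, blast, linarith)
    then have "(u', v', t') \<in> A \<times> B" using n1 n2 r y C(5) by blast
    then show ?thesis using A(5) y by auto
  qed
  then show ?case by blast
qed

text \<open>The unit ball of \<open>q\<close> contains a ball of some \<open>tree_gauge\<close>, and
  homogeneity turns the inclusion into a bound. Hoelder conditions can thus be expressed by the
  sequence \<open>p\<close> alone.\<close>

lemma pgauge_dominated: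
  assumes "pgauge a sm T j q"
  obtains n C where "0 \<le> C" "\<And>x. x \<in> lev j \<Longrightarrow> q x \<le> C * tree_gauge a (p n) x"
proof -
  obtain S where S: "openin (ptop a T j) S" "pzero j \<in> S" "S \<subseteq> {x \<in> lev j. q x < 1}"
    using assms unfolding pgauge_def by (meson zero_less_one)
  then obtain n where n: "\<forall>y\<in>lev j. near n (pzero j) y \<longrightarrow> y \<in> S" using tree_gauge_base by blast
  have "q x \<le> inverse (kap * (1 / (real n + 1))) * tree_gauge a (p n) x" if x: "x \<in> lev j" for x
  proof (rule homogeneous_le)
    fix t assume "a t * tree_gauge a (p n) x < 1 / (real n + 1)"
    then have "psmul sm t x \<in> S"
      using n psmul_lev[OF x] by (simp add: psub_pzero[OF psmul_lev[OF x]] tree_gauge_psmul[OF p_gauge])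
    then show "a t * q x < 1" using S(3) assms x unfolding pgauge_def by auto
  qed (auto simp: tree_gauge_nonneg[OF p_gauge])
  then show ?thesis using that[of "inverse (kap * (1 / (real n + 1)))" n] kap by simp
qed

text \<open>The form of the Hoelder condition that suits sequences: one index \<open>N\<close> fixes
  both the neighbourhood and the gauge, and by monotonicity of \<open>p\<close> it may be
  enlarged.\<close>

lemma holder_local:
  assumes h: "holder0 a sm T smC TC \<sigma> j D h" and D: "D \<subseteq> lev j" and x0: "x0 \<in> D"
    and q: "gauge a smC TC q" and \<sigma>: "0 < \<sigma>"
  obtains N C where "0 \<le> C" "\<And>x y. x \<in> D \<Longrightarrow> y \<in> D \<Longrightarrow> near N x0 x \<Longrightarrow> near N x0 y \<Longrightarrow>
      q (h y - h x) \<le> (C * tree_gauge a (p N) (psub y x)) powr \<sigma>"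
proof -
  obtain r W where r: "pgauge a sm T j r" and W: "W \<subseteq> D"
      "\<exists>Ov. openin (ptop a T j) Ov \<and> x0 \<in> Ov \<and> Ov \<inter> D \<subseteq> W"
      "\<forall>x\<in>W. \<forall>y\<in>W. q (h y - h x) \<le> (r (psub y x)) powr \<sigma>"
    using h x0 q unfolding holder0_def by meson
  obtain Ov where Ov: "openin (ptop a T j) Ov" "x0 \<in> Ov" "Ov \<inter> D \<subseteq> W" using W(2) by blast
  obtain m where m: "\<forall>y\<in>lev j. near m x0 y \<longrightarrow> y \<in> Ov" using tree_gauge_base[OF Ov(1,2)] by blast
  obtain n C where C: "0 \<le> C" "\<And>x. x \<in> lev j \<Longrightarrow> r x \<le> C * tree_gauge a (p n) x"
    by (rule pgauge_dominated[OF r]) blast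
  define N where "N = max m n"
  have "q (h y - h x) \<le> (C * tree_gauge a (p N) (psub y x)) powr \<sigma>"
    if xy: "x \<in> D" "y \<in> D" "near N x0 x" "near N x0 y" for x y
  proof -
    have "near m x0 x" "near m x0 y" using near_mono[OF xy(3), of m] near_mono[OF xy(4), of m] N_def by auto
    then have "x \<in> W" "y \<in> W" using m Ov(3) D xy by auto
    then have "q (h y - h x) \<le> (r (psub y x)) powr \<sigma>" using W(3) by blast
    moreover have l: "psub y x \<in> lev j" using psub_lev xy D by blast
    have "r (psub y x) \<le> C * tree_gauge a (p N) (psub y x)"
    proof -
      have "r (psub y x) \<le> C * tree_gauge a (p n) (psub y x)" using C(2)[OF l] .
      also have "\<dots> \<le> C * tree_gauge a (p N) (psub y x)"
      using C(1) N_def by (intro mult_left_mono tree_gauge_mono p_mono) auto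
      finally show ?thesis .
    qed
    then have "(r (psub y x)) powr \<sigma> \<le> (C * tree_gauge a (p N) (psub y x)) powr \<sigma>"
      using \<sigma> r l unfolding pgauge_def by (intro powr_mono2) auto
    ultimately show ?thesis by linarith
  qed
  then show ?thesis using that C(1) by blast
qed

end

section \<open>Weak Hoelder differentiability\<close>

lemma eventually_bounded:
  fixes f :: "nat \<Rightarrow> real"
  assumes "\<And>n. n \<ge> N \<Longrightarrow> f n \<le> K" shows "\<exists>R. \<forall>n. f n \<le> R"
proof -
  have "f n \<le> max K (Max (f ` {..N}))" for n
    using assms[of n] by (cases "n \<le> N") (auto simp: le_max_iff_disj)
  then show ?thesis by blast
qed

section \<open>The scalars as a vector space, and curves in the domains\<close>

context absval
begin

lemma scalar_tvs: "tvs a (*) (ktop a)"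
proof -
  interpret Metric_space UNIV "\<lambda>x y. a (x - y)" by (rule Metric)
  have rect: "openin (prod_topology (ktop a) (ktop a)) ({s. a (s - x) < r} \<times> {t. a (t - y) < r'})" for x y r r'
    by (simp add: openin_prod_Times_iff ball_open)
  have "continuous_map (prod_topology (ktop a) (ktop a)) (ktop a) (\<lambda>(x, y). x + y)"
    unfolding continuous_map_ktop
  proof safe
    fix x y \<epsilon> assume e: "\<epsilon> > (0::real)"
    have "a ((s + t) - (x + y)) < \<epsilon>" if "a (s - x) < \<epsilon> / 2" "a (t - y) < \<epsilon> / 2" for s t
    proof -
      have "(s + t) - (x + y) = (s - x) + (t - y)" by simp
      then have "a ((s + t) - (x + y)) \<le> a (s - x) + a (t - y)" by (metis a_add)
      then show ?thesis using that by linarith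
    qed
    then show "\<exists>O'. openin (prod_topology (ktop a) (ktop a)) O' \<and> (x, y) \<in> O' \<and>
        (\<forall>z\<in>O'. a ((case z of (x, y) \<Rightarrow> x + y) - (x + y)) < \<epsilon>)"
      using rect[of x "\<epsilon> / 2" y "\<epsilon> / 2"] e
      by (intro exI[of _ "{s. a (s - x) < \<epsilon> / 2} \<times> {t. a (t - y) < \<epsilon> / 2}"]) auto
  qed
  moreover have "continuous_map (prod_topology (ktop a) (ktop a)) (ktop a) (\<lambda>(x, y). x * y)"
    unfolding continuous_map_ktop
  proof safe
    fix x y \<epsilon> assume e: "\<epsilon> > (0::real)"
    define K where "K = a x + a y + 1"
    have K: "K > 0" unfolding K_def by (simp add: add_nonneg_pos)
    define d where "d = min 1 (\<epsilon> / (2 * K))"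
    have d: "0 < d" "d \<le> 1" "d * K < \<epsilon>" unfolding d_def using e K by (auto simp: min_def field_simps)
    have "a (s * t - x * y) < \<epsilon>" if "a (s - x) < d" "a (t - y) < d" for s t
    proof -
      have "s * t - x * y = (s - x) * (t - y) + ((s - x) * y + x * (t - y))" by (simp add: algebra_simps)
      then have "a (s * t - x * y) \<le> a (s - x) * a (t - y) + (a (s - x) * a y + a x * a (t - y))"
        by (metis a_add a_mult add_left_mono order_trans)
      also have "\<dots> \<le> d * 1 + (d * a y + a x * d)"
        using that d by (intro add_mono mult_mono) auto
      also have "\<dots> = d * K" unfolding K_def by (simp add: algebra_simps)
      finally show ?thesis using d(3) by linarith
    qed
    then show "\<exists>O'. openin (prod_topology (ktop a) (ktop a)) O' \<and> (x, y) \<in> O' \<and>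
        (\<forall>z\<in>O'. a ((case z of (x, y) \<Rightarrow> x * y) - x * y) < \<epsilon>)"
      using rect[of x d y d] d
      by (intro exI[of _ "{s. a (s - x) < d} \<times> {t. a (t - y) < d}"]) auto
  qed
  moreover have "Hausdorff_space (ktop a)" unfolding ktop_eq by (rule Hausdorff_space_mtopology)
  ultimately show ?thesis unfolding tvs_def by (auto simp: algebra_simps)
qed

end

context absval_tvs
begin

text \<open>Along curves, the domains behave like open sets: evaluating the condition
  \<open>x + t y \<in> pdom sm U n\<close> along a curve produces another curve one level lower.\<close>
primrec curve :: "nat \<Rightarrow> ('k \<Rightarrow> ('v, 'k) bpt) \<Rightarrow> bool" where
  "curve 0 \<gamma> \<longleftrightarrow> (\<exists>g. \<gamma> = (\<lambda>t. BLeaf (g t)) \<and> continuous_map (ktop a) T g)"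
| "curve (Suc n) \<gamma> \<longleftrightarrow> (\<exists>\<gamma>1 \<gamma>2 r. \<gamma> = (\<lambda>t. BNode (\<gamma>1 t) (\<gamma>2 t) (r t)) \<and> curve n \<gamma>1 \<and> curve n \<gamma>2
    \<and> continuous_map (ktop a) (ktop a) r)"

lemma curve_SucI:
  assumes "curve n u" "curve n v" "continuous_map (ktop a) (ktop a) r"
  shows "curve (Suc n) (\<lambda>t. BNode (u t) (v t) (r t))"
  unfolding curve.simps using assms by (intro exI[of _ u] exI[of _ v] exI[of _ r]) simp

lemma curve_lev: "curve n \<gamma> \<Longrightarrow> \<gamma> t \<in> lev n"
  by (induction n arbitrary: \<gamma>) auto

lemma curve_const: "x \<in> lev n \<Longrightarrow> curve n (\<lambda>_. x)"
  by (induction n arbitrary: x) fastforce+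

lemma curve_add: "curve n \<gamma> \<Longrightarrow> curve n \<delta> \<Longrightarrow> curve n (\<lambda>t. padd (\<gamma> t) (\<delta> t))"
proof (induction n arbitrary: \<gamma> \<delta>)
  case 0
  then obtain g d where "\<gamma> = (\<lambda>t. BLeaf (g t))" "continuous_map (ktop a) T g"
    "\<delta> = (\<lambda>t. BLeaf (d t))" "continuous_map (ktop a) T d" by auto
  then show ?case using cont_pair[of "ktop a" g d] by auto
next
  case (Suc n)
  interpret K: absval_tvs a "(*)" "ktop a" by unfold_locales (rule scalar_tvs)
  obtain u v r where g: "\<gamma> = (\<lambda>t. BNode (u t) (v t) (r t))" "curve n u" "curve n v"
    "continuous_map (ktop a) (ktop a) r" using Suc.prems(1) by auto
  obtain u' v' r' where d: "\<delta> = (\<lambda>t. BNode (u' t) (v' t) (r' t))" "curve n u'" "curve n v'"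
    "continuous_map (ktop a) (ktop a) r'" using Suc.prems(2) by auto
  show ?case
    using curve_SucI[OF Suc.IH[OF g(2) d(2)] Suc.IH[OF g(3) d(3)] K.cont_pair[OF g(4) d(4)]]
    unfolding g(1) d(1) by (simp del: curve.simps)
qed

lemma curve_scale: "curve n \<gamma> \<Longrightarrow> continuous_map (ktop a) (ktop a) s \<Longrightarrow> curve n (\<lambda>t. psmul sm (s t) (\<gamma> t))"
proof (induction n arbitrary: \<gamma>)
  case 0
  then obtain g where "\<gamma> = (\<lambda>t. BLeaf (g t))" "continuous_map (ktop a) T g" by auto
  then show ?case using cont_scale[OF 0(2), of g] by auto
next
  case (Suc n)
  interpret K: absval_tvs a "(*)" "ktop a" by unfold_locales (rule scalar_tvs)
  obtain u v r where g: "\<gamma> = (\<lambda>t. BNode (u t) (v t) (r t))" "curve n u" "curve n v"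
    "continuous_map (ktop a) (ktop a) r" using Suc.prems(1) by auto
  show ?case
    using curve_SucI[OF Suc.IH[OF g(2) Suc.prems(2)] Suc.IH[OF g(3) Suc.prems(2)]
        K.cont_scale[OF Suc.prems(2) g(4)]]
    unfolding g(1) by (simp del: curve.simps)
qed

text \<open>Supplies, near a point \<open>BNode x y 0\<close> of the domain, the points with nonzero
  last entry at which difference quotients are formed.\<close>

lemma curve_in_pdom:
  assumes U: "openin T U" and "curve n \<gamma>" "\<gamma> 0 \<in> pdom sm U n"
  shows "\<exists>\<delta>>0. \<forall>t. a t < \<delta> \<longrightarrow> \<gamma> t \<in> pdom sm U n"
  using assms(2,3)
proof (induction n arbitrary: \<gamma>)
  case 0
  then obtain g where g: "\<gamma> = (\<lambda>t. BLeaf (g t))" "continuous_map (ktop a) T g" by auto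
  have "openin (ktop a) {t. g t \<in> U}" using openin_continuous_map_preimage[OF g(2) U] by simp
  moreover have "0 \<in> {t. g t \<in> U}" using 0(2) g by auto
  ultimately obtain \<delta> where "\<delta> > 0" "\<And>t. a (t - 0) < \<delta> \<Longrightarrow> t \<in> {t. g t \<in> U}"
    unfolding openin_ktop by blast
  then show ?case using g by auto
next
  case (Suc n)
  obtain u v r where g: "\<gamma> = (\<lambda>t. BNode (u t) (v t) (r t))" "curve n u" "curve n v"
    "continuous_map (ktop a) (ktop a) r" using Suc.prems(1) by auto
  define w where "w t = padd (u t) (psmul sm (r t) (v t))" for t
  have w: "curve n w" unfolding w_def using curve_add[OF g(2) curve_scale[OF g(3,4)]] .
  have "u 0 \<in> pdom sm U n" "w 0 \<in> pdom sm U n" using Suc.prems(2) g(1) unfolding w_def by auto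
  then obtain d d' where d: "d > 0" "\<forall>t. a t < d \<longrightarrow> u t \<in> pdom sm U n"
    "d' > 0" "\<forall>t. a t < d' \<longrightarrow> w t \<in> pdom sm U n" using Suc.IH[OF g(2)] Suc.IH[OF w] by blast
  have "\<gamma> t \<in> pdom sm U (Suc n)" if "a t < min d d'" for t
    using d that curve_lev[OF g(3)] unfolding g(1) w_def by simp
  then show ?case using d by (intro exI[of _ "min d d'"]) simp
qed

lemma tree_gauge_psub_self: "gauge a sm T p \<Longrightarrow> tree_gauge a p (psub x x) = 0"
  using gaugeD(2)[of a sm T p 0 0] by (induction x) auto

end

section \<open>From weak to strong Hoelder estimates\<close>

locale weak_setting = gauge_base a smE TE p + F: absval_tvs a smF TF
  for a :: "'k::field \<Rightarrow> real" and smE :: "'k \<Rightarrow> 'e::ab_group_add \<Rightarrow> 'e" and TE p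
    and smF :: "'k \<Rightarrow> 'f::ab_group_add \<Rightarrow> 'f" and TF +
  fixes \<sigma> :: real
  assumes Mackey: "\<And>B W. weakly_bounded a smF TF B \<Longrightarrow> zero_nbhd TF W \<Longrightarrow>
      \<exists>\<delta>>0. \<forall>t x. a t < \<delta> \<longrightarrow> x \<in> B \<longrightarrow> smF t x \<in> W"
    and \<sigma>: "0 < \<sigma>"
begin

definition dual :: "('f \<Rightarrow> 'k) \<Rightarrow> bool" where
  "dual l \<longleftrightarrow> lin_functional smF l \<and> continuous_map TF (ktop a) l"

lemma dual_simps:
  assumes "dual l"
  shows "l (x + y) = l x + l y" "l (smF t x) = t * l x" "l (x - y) = l x - l y"
proof -
  show add: "\<And>x y. l (x + y) = l x + l y" and "l (smF t x) = t * l x"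
    using assms unfolding dual_def lin_functional_def by auto
  show "l (x - y) = l x - l y" using add[of "x - y" y] by simp
qed

text \<open>Follows from \<open>Mackey\<close>: if every functional vanishes at
  \<open>v - w\<close>, the whole line through it is weakly bounded, so each 0-neighbourhood absorbs
  that line and contains \<open>v - w\<close>; the Hausdorff property finishes.\<close>

lemma dual_separates:
  assumes "\<And>l. dual l \<Longrightarrow> l v = l w" shows "v = w"
proof -
  have l0: "l (v - w) = 0" if "dual l" for l using assms[OF that] dual_simps[OF that] by simp
  have "v - w = 0"
  proof (rule F.zero_nbhds_separate)
    fix W assume W: "zero_nbhd TF W"
    have "weakly_bounded a smF TF (range (\<lambda>t. smF t (v - w)))"
      unfolding weakly_bounded_def dual_def[symmetric]
      by (auto simp: l0 dual_simps(2) intro!: exI[of _ 0])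
    then obtain \<delta> where d: "\<delta> > 0" "\<And>t s. a t < \<delta> \<Longrightarrow> smF t (smF s (v - w)) \<in> W"
      using Mackey[OF _ W] by blast
    obtain t where "t \<noteq> 0" "a t < \<delta>" using small[OF d(1)] by blast
    then show "v - w \<in> W" using d(2)[of t "inverse t"] F.sm_inverse by simp
  qed
  then show ?thesis by simp
qed

lemma holder_continuous:
  assumes h: "holder0 a smE TE smF TF \<sigma> j D h" and D: "D \<subseteq> lev j"
  shows "continuous_map (subtopology (ptop a TE j) D) TF h"
  unfolding continuous_map_def
proof (intro conjI allI impI)
  fix U assume U: "openin TF U"
  show "openin (subtopology (ptop a TE j) D) {x \<in> topspace (subtopology (ptop a TE j) D). h x \<in> U}"
  proof (subst openin_subopen, intro ballI)
    fix x0 assume "x0 \<in> {x \<in> topspace (subtopology (ptop a TE j) D). h x \<in> U}"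
    then have x0: "x0 \<in> D" "x0 \<in> lev j" "h x0 \<in> U" by (auto simp: topspace_subtopology)
    obtain q where q: "gauge a smF TF q" "\<And>y. q y < 1 \<Longrightarrow> y \<in> {y. h x0 + y \<in> U}"
      by (rule F.exists_gauge[OF F.zero_nbhd_translate[OF U x0(3)]]) blast
    obtain N C where C: "0 \<le> C" "\<And>x y. x \<in> D \<Longrightarrow> y \<in> D \<Longrightarrow> near N x0 x \<Longrightarrow> near N x0 y \<Longrightarrow>
        q (h y - h x) \<le> (C * tree_gauge a (p N) (psub y x)) powr \<sigma>"
      by (rule holder_local[OF h D x0(1) q(1) \<sigma>]) blast
    \<comment> \<open>With \<open>C + 1\<close> the quotient is positive also for
      \<open>C = 0\<close>, and \<open>C / (C + 1) < 1\<close> brings the Hoelder bound below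
      1.\<close>
    define r where "r = min (1 / (real N + 1)) (1 / (C + 1))"
    have "r > 0" using C(1) unfolding r_def by simp
    obtain S where S: "openin (ptop a TE j) S" "x0 \<in> S" "\<forall>y\<in>S. y \<in> lev j \<and> tree_gauge a (p N) (psub y x0) < r"
      using tree_gauge_nbhd[OF p_gauge x0(2) \<open>r > 0\<close>] by blast
    have "h y \<in> U" if y: "y \<in> S" "y \<in> D" for y
    proof -
      have *: "tree_gauge a (p N) (psub y x0) < r" "tree_gauge a (p N) (psub x0 x0) < r" using S y by auto
      then have "q (h y - h x0) \<le> (C * tree_gauge a (p N) (psub y x0)) powr \<sigma>"
        using C(2)[OF x0(1) y(2)] unfolding r_def by simp
      also have "\<dots> < 1 powr \<sigma>"
      proof -
        have "C * tree_gauge a (p N) (psub y x0) \<le> C * (1 / (C + 1))"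
          using * C(1) unfolding r_def by (intro mult_left_mono) auto
        moreover have "C * (1 / (C + 1)) < 1" using C(1) by simp
        ultimately have "C * tree_gauge a (p N) (psub y x0) < 1" by linarith
        then show ?thesis
          using \<sigma> C(1) tree_gauge_nonneg[OF p_gauge] by (intro powr_less_mono2) auto
      qed
      finally have "q (h y - h x0) < 1" by simp
      from q(2)[OF this] show ?thesis by simp
    qed
    moreover have "openin (subtopology (ptop a TE j) D) (S \<inter> D)"
      using S(1) by (auto simp: openin_subtopology)
    ultimately show "\<exists>V. openin (subtopology (ptop a TE j) D) V \<and> x0 \<in> V \<and>
        V \<subseteq> {x \<in> topspace (subtopology (ptop a TE j) D). h x \<in> U}"
      using S x0 by (intro exI[of _ "S \<inter> D"]) (auto simp: topspace_subtopology)
  qed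
qed simp

text \<open>A failure at \<open>x0\<close> yields pairs \<open>X n\<close>, \<open>Y n\<close>
  approaching \<open>x0\<close> whose increments beat the Hoelder bound with constant
  \<open>n + 1\<close>. Suitably rescaled, the increments are weakly bounded, yet \<open>q\<close>
  is unbounded on them, which \<open>Mackey\<close> forbids.\<close>

lemma weakly_holder_imp_holder:
  assumes weak: "\<And>l. dual l \<Longrightarrow> holder0 a smE TE (*) (ktop a) \<sigma> j D (\<lambda>x. l (h x))"
    and D: "D \<subseteq> lev j"
  shows "holder0 a smE TE smF TF \<sigma> j D h"
proof (rule ccontr)
  assume "\<not> holder0 a smE TE smF TF \<sigma> j D h"
  then obtain x0 q where x0: "x0 \<in> D" and q: "gauge a smF TF q"
    and neg: "\<not> (\<exists>p W. pgauge a smE TE j p \<and> W \<subseteq> D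
         \<and> (\<exists>Ov. openin (ptop a TE j) Ov \<and> x0 \<in> Ov \<and> Ov \<inter> D \<subseteq> W)
         \<and> (\<forall>x\<in>W. \<forall>y\<in>W. q (h y - h x) \<le> (p (psub y x)) powr \<sigma>))"
    unfolding holder0_def by blast
  have no: "\<exists>x\<in>W. \<exists>y\<in>W. (r (psub y x)) powr \<sigma> < q (h y - h x)"
    if "pgauge a smE TE j r" "W \<subseteq> D" "\<exists>Ov. openin (ptop a TE j) Ov \<and> x0 \<in> Ov \<and> Ov \<inter> D \<subseteq> W" for r W
  proof (rule ccontr)
    assume "\<not> ?thesis"
    then have "\<forall>x\<in>W. \<forall>y\<in>W. q (h y - h x) \<le> (r (psub y x)) powr \<sigma>" by (simp add: not_less)
    then show False using neg that by blast
  qed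
  have "\<exists>x y. x \<in> D \<and> y \<in> D \<and> near n x0 x \<and> near n x0 y \<and>
      ((real n + 1) * tree_gauge a (p n) (psub y x)) powr \<sigma> < q (h y - h x)" for n
  proof -
    have "\<exists>x\<in>{x \<in> D. near n x0 x}. \<exists>y\<in>{x \<in> D. near n x0 x}.
        ((real n + 1) * tree_gauge a (p n) (psub y x)) powr \<sigma> < q (h y - h x)"
    proof (rule no)
      show "pgauge a smE TE j (\<lambda>x. (real n + 1) * tree_gauge a (p n) x)"
        by (rule pgauge_scaled_tree_gauge[OF p_gauge]) simp
      have "x0 \<in> lev j" "0 < 1 / (real n + 1)" using x0 D by auto
      from tree_gauge_nbhd[OF p_gauge[of n] this]
      obtain S where "openin (ptop a TE j) S" "x0 \<in> S" "\<forall>y\<in>S. y \<in> lev j \<and> near n x0 y"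
        by (elim exE conjE)
      then show "\<exists>Ov. openin (ptop a TE j) Ov \<and> x0 \<in> Ov \<and> Ov \<inter> D \<subseteq> {x \<in> D. near n x0 x}" by blast
    qed blast
    then show ?thesis by blast
  qed
  then obtain X Y where XY: "\<And>n. X n \<in> D" "\<And>n. Y n \<in> D" "\<And>n. near n x0 (X n)" "\<And>n. near n x0 (Y n)"
    and big: "\<And>n. ((real n + 1) * tree_gauge a (p n) (psub (Y n) (X n))) powr \<sigma> < q (h (Y n) - h (X n))"
    by metis
  define g where "g n = tree_gauge a (p n) (psub (Y n) (X n))" for n
  have g: "0 \<le> g n" for n unfolding g_def by (rule tree_gauge_nonneg[OF p_gauge])
  \<comment> \<open>The distance \<open>g n\<close> may be 0, so the increment is not divided by a
    scalar of size about \<open>g n powr \<sigma>\<close>. \<open>R n\<close> is always positive and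
    exceeds that number, which keeps the quotients weakly bounded, while it is smaller than the
    increment by the factor \<open>(real n + 1) powr \<sigma>\<close>, which makes
    \<open>q (z n)\<close> grow.\<close>
  define R where "R n = q (h (Y n) - h (X n)) / (real n + 1) powr \<sigma>" for n
  have R: "g n powr \<sigma> < R n" for n
  proof -
    have "(real n + 1) powr \<sigma> * g n powr \<sigma> < q (h (Y n) - h (X n))"
      using big[of n] powr_mult[of "real n + 1" "g n" \<sigma>] g[of n] by (simp flip: g_def)
    moreover have "0 < (real n + 1) powr \<sigma>" by simp
    ultimately show ?thesis unfolding R_def by (simp only: pos_less_divide_eq mult.commute)
  qed
  have Rpos: "0 < R n" for n using R[of n] by (rule order_le_less_trans[rotated]) simp
  have "\<exists>t. t \<noteq> 0 \<and> kap * R n \<le> a t \<and> a t < R n" for n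
    by (rule scalar_approx[OF Rpos[of n]]) blast
  then obtain c where c: "\<And>n. c n \<noteq> 0" "\<And>n. kap * R n \<le> a (c n)" "\<And>n. a (c n) < R n" by metis
  define z where "z n = smF (inverse (c n)) (h (Y n) - h (X n))" for n
  have qz: "(real n + 1) powr \<sigma> < q (z n)" for n
  proof -
    have "q (z n) = R n * (real n + 1) powr \<sigma> / a (c n)"
      unfolding z_def R_def gaugeD(2)[OF q] a_inverse[OF c(1)] by (simp add: field_simps)
    moreover have "a (c n) * (real n + 1) powr \<sigma> < R n * (real n + 1) powr \<sigma>"
      using c(3)[of n] by (intro mult_strict_right_mono) auto
    ultimately show ?thesis using a_pos[OF c(1)[of n]] by (simp add: field_simps)
  qed
  have "weakly_bounded a smF TF (range z)"
    unfolding weakly_bounded_def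
  proof (intro allI impI)
    fix l assume "lin_functional smF l \<and> continuous_map TF (ktop a) l"
    then have l: "dual l" unfolding dual_def .
    obtain N C where C: "0 \<le> C" "\<And>x y. x \<in> D \<Longrightarrow> y \<in> D \<Longrightarrow> near N x0 x \<Longrightarrow> near N x0 y \<Longrightarrow>
        a (l (h y) - l (h x)) \<le> (C * tree_gauge a (p N) (psub y x)) powr \<sigma>"
      by (rule holder_local[OF weak[OF l] D x0 gauge_absval \<sigma>]) blast
    have "a (l (z n)) \<le> C powr \<sigma> / kap" if n: "n \<ge> N" for n
    proof -
      have "a (l (h (Y n)) - l (h (X n))) \<le> (C * tree_gauge a (p N) (psub (Y n) (X n))) powr \<sigma>"
        using C(2) XY near_mono[OF _ n] by blast
      also have "\<dots> \<le> (C * g n) powr \<sigma>"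
        unfolding g_def using C(1) \<sigma> n tree_gauge_nonneg[OF p_gauge]
        by (intro powr_mono2 mult_left_mono tree_gauge_mono p_mono) auto
      also have "\<dots> = C powr \<sigma> * g n powr \<sigma>" using C(1) g by (simp add: powr_mult)
      also have "\<dots> \<le> C powr \<sigma> * (a (c n) / kap)"
      proof (rule mult_left_mono)
        have "kap * g n powr \<sigma> \<le> kap * R n" using R[of n] kap by (intro mult_left_mono) auto
        then have "kap * g n powr \<sigma> \<le> a (c n)" using c(2)[of n] by linarith
        then show "g n powr \<sigma> \<le> a (c n) / kap" using kap by (simp add: field_simps)
      qed simp
      finally have "a (l (h (Y n)) - l (h (X n))) \<le> C powr \<sigma> / kap * a (c n)" by simp
      then show ?thesis unfolding z_def dual_simps[OF l] a_mult a_inverse[OF c(1)]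
        using a_pos[OF c(1)[of n]] by (simp add: field_simps)
    qed
    then have "\<exists>R. \<forall>n. a (l (z n)) \<le> R" by (rule eventually_bounded)
    then show "\<exists>R. \<forall>x\<in>range z. a (l x) \<le> R" by auto
  qed
  then obtain \<delta> where d: "\<delta> > 0" "\<And>t n. a t < \<delta> \<Longrightarrow> smF t (z n) \<in> {x. q x < 1}"
    using Mackey[OF _ gaugeD(3)[OF q, of 1], of "range z"] by auto
  obtain t where t: "t \<noteq> 0" "a t < \<delta>" using small[OF d(1)] by blast
  have "(real n + 1) powr \<sigma> < inverse (a t)" for n
  proof -
    have "a t * q (z n) < 1" using d(2)[OF t(2), of n] gaugeD(2)[OF q] by simp
    then have "q (z n) < inverse (a t)" using a_pos[OF t(1)] by (simp add: field_simps)
    then show ?thesis using qz[of n] by linarith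
  qed
  moreover obtain n where n: "inverse (a t) powr (1 / \<sigma>) < real n" using reals_Archimedean2 by blast
  moreover have "inverse (a t) = (inverse (a t) powr (1 / \<sigma>)) powr \<sigma>"
    using \<sigma> a_pos[OF t(1)] by (simp add: powr_powr)
  moreover have "\<dots> \<le> (real n + 1) powr \<sigma>" using n \<sigma> by (intro powr_mono2) auto
  ultimately show False by (metis not_less)
qed

end

lemma holder0_cong:
  assumes h: "holder0 a smE TE smC TC \<sigma> j D h" and eq: "\<And>x. x \<in> D \<Longrightarrow> h x = h' x"
  shows "holder0 a smE TE smC TC \<sigma> j D h'"
  unfolding holder0_def
proof (intro ballI allI impI)
  fix x0 q assume "x0 \<in> D" "gauge a smC TC q"
  then obtain p W where pW: "pgauge a smE TE j p" "W \<subseteq> D"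
    "\<exists>Ov. openin (ptop a TE j) Ov \<and> x0 \<in> Ov \<and> Ov \<inter> D \<subseteq> W"
    "\<forall>x\<in>W. \<forall>y\<in>W. q (h y - h x) \<le> (p (psub y x)) powr \<sigma>"
    using h unfolding holder0_def by meson
  moreover have "\<forall>x\<in>W. \<forall>y\<in>W. q (h' y - h' x) \<le> (p (psub y x)) powr \<sigma>"
    using pW(2,4) eq by (metis subsetD)
  ultimately show "\<exists>p W. pgauge a smE TE j p \<and> W \<subseteq> D
      \<and> (\<exists>Ov. openin (ptop a TE j) Ov \<and> x0 \<in> Ov \<and> Ov \<inter> D \<subseteq> W)
      \<and> (\<forall>x\<in>W. \<forall>y\<in>W. q (h' y - h' x) \<le> (p (psub y x)) powr \<sigma>)" by blast
qed

context weak_setting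
begin

text \<open>The scalars witnessing the Mackey--Cauchy property depend on \<open>min n m\<close> only: for each
  functional the Hoelder estimate holds from some index on, so this leaves finitely many
  scalars to be treated separately.\<close>
lemma extension_at_zero:
  assumes U: "openin TE U" and complete: "mackey_complete a smF TF"
    and x: "x \<in> pdom smE U j" and y: "y \<in> lev j"
    and g: "\<And>l t. dual l \<Longrightarrow> t \<noteq> 0 \<Longrightarrow> BNode x y t \<in> pdom smE U (Suc j) \<Longrightarrow> l (g t) = G l (BNode x y t)"
    and G: "\<And>l. dual l \<Longrightarrow> holder0 a smE TE (*) (ktop a) \<sigma> (Suc j) (pdom smE U (Suc j)) (G l)"
  shows "\<exists>v. \<forall>l. dual l \<longrightarrow> l v = G l (BNode x y 0)"
proof -
  define D where "D = pdom smE U (Suc j)"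
  define X where "X t = BNode x y t" for t
  have xl: "x \<in> lev j" using x pdom_subset_lev by blast
  have curve: "curve (Suc j) X"
    unfolding X_def by (rule curve_SucI[OF curve_const[OF xl] curve_const[OF y]]) simp
  have "padd x (psmul smE 0 y) = x" using xl y by (induction j arbitrary: x y) auto
  then have X0: "X 0 \<in> D" unfolding X_def D_def using x y by simp
  obtain \<delta> where \<delta>: "\<delta> > 0" "\<And>t. a t < \<delta> \<Longrightarrow> X t \<in> D"
    using curve_in_pdom[OF U curve] X0 unfolding D_def by blast
  have DL: "D \<subseteq> lev (Suc j)" unfolding D_def by (rule pdom_subset_lev)
  have pgX: "tree_gauge a (p n) (psub (X t) (X s)) = a (t - s)" for n t s
    unfolding X_def by (simp add: tree_gauge_psub_self[OF p_gauge])
  obtain c where c: "c \<noteq> 0" "a c < \<delta>" using small[OF \<delta>(1)] by blast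
  \<comment> \<open>A geometric sequence has decreasing sizes, so the entry with the smaller index
    bounds a difference of two entries up to the factor 2.\<close>
  define \<tau> where "\<tau> n = c * unif ^ n" for n
  have a\<tau>: "a (\<tau> n) = a c * kap ^ n" for n unfolding \<tau>_def by (simp add: a_mult a_power kap_def)
  have \<tau>0: "\<tau> n \<noteq> 0" for n unfolding \<tau>_def using c unif by simp
  have \<tau>_dec: "a (\<tau> n) \<le> a (\<tau> m)" if "m \<le> n" for m n
    unfolding a\<tau> using kap that by (intro mult_left_mono power_decreasing) auto
  have X\<tau>: "X (\<tau> n) \<in> D" for n using \<tau>_dec[of 0 n] c(2) a\<tau>[of 0] by (intro \<delta>(2)) simp
  have \<tau>_lim: "\<exists>N. \<forall>n\<ge>N. a (\<tau> n) < e" if e: "e > 0" for e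
  proof -
    obtain N where "kap ^ N < e / a c" using real_arch_pow_inv[of "e / a c" kap] kap e a_pos[OF c(1)] by auto
    then have "a (\<tau> N) < e" unfolding a\<tau> using a_pos[OF c(1)] by (simp add: field_simps)
    then show ?thesis using \<tau>_dec order_le_less_trans by blast
  qed
  \<comment> \<open>Scalars matching the Hoelder rate up to \<open>kap\<close>: the lower bound
    keeps the rescaled differences weakly bounded, the upper bound makes \<open>d n\<close> tend to
    0.\<close>
  have "\<exists>d. d \<noteq> 0 \<and> kap * a (\<tau> n) powr \<sigma> \<le> a d \<and> a d < a (\<tau> n) powr \<sigma>" for n
  proof -
    have "0 < a (\<tau> n) powr \<sigma>" using \<tau>0[of n] by simp
    then show ?thesis by (rule scalar_approx) blast
  qed
  then obtain d where d: "\<And>n. d n \<noteq> 0" "\<And>n. kap * a (\<tau> n) powr \<sigma> \<le> a (d n)" "\<And>n. a (d n) < a (\<tau> n) powr \<sigma>"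
    by metis
  define z where "z n = g (\<tau> n)" for n
  have lz: "l (z n) = G l (X (\<tau> n))" if "dual l" for l n
    unfolding z_def X_def using g[OF that \<tau>0] X\<tau>[of n] unfolding X_def D_def by blast
  \<comment> \<open>All points compared lie on the curve \<open>X\<close>, where the tree gauge of a
    difference is the size of the difference of the parameters (\<open>pgX\<close>). The threshold
    \<open>M\<close> depends on \<open>l\<close>.\<close>
  have local: "\<exists>M C. 0 \<le> C \<and> (\<forall>n\<ge>M. \<forall>m\<ge>M. a (l (z n) - l (z m)) \<le> (C * a (\<tau> n - \<tau> m)) powr \<sigma>)
      \<and> (\<forall>n\<ge>M. a (l (z n) - G l (X 0)) \<le> (C * a (\<tau> n)) powr \<sigma>)" if l: "dual l" for l
  proof -
    obtain N C where C: "0 \<le> C" "\<And>x y. x \<in> D \<Longrightarrow> y \<in> D \<Longrightarrow> near N (X 0) x \<Longrightarrow> near N (X 0) y \<Longrightarrow>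
        a (G l y - G l x) \<le> (C * tree_gauge a (p N) (psub y x)) powr \<sigma>"
      by (rule holder_local[OF G[OF l, folded D_def] DL X0 gauge_absval \<sigma>]) blast
    obtain M where M: "\<And>n. n \<ge> M \<Longrightarrow> a (\<tau> n) < 1 / (real N + 1)"
      using \<tau>_lim[of "1 / (real N + 1)"] by auto
    have "near N (X 0) (X (\<tau> n))" if "n \<ge> M" for n using M[OF that] by (simp add: pgX)
    moreover have "near N (X 0) (X 0)" by (simp add: pgX)
    ultimately have "\<forall>n\<ge>M. \<forall>m\<ge>M. a (l (z n) - l (z m)) \<le> (C * a (\<tau> n - \<tau> m)) powr \<sigma>"
      "\<forall>n\<ge>M. a (l (z n) - G l (X 0)) \<le> (C * a (\<tau> n)) powr \<sigma>"
      using C(2)[OF X\<tau> X\<tau>] C(2)[OF X0 X\<tau>] by (auto simp: lz[OF l] pgX)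
    then show ?thesis using C(1) by blast
  qed
  define B where "B = {smF (inverse (d (min n m))) (z n - z m) | n m. True}"
  have "weakly_bounded a smF TF B"
    unfolding weakly_bounded_def dual_def[symmetric]
  proof (intro allI impI)
    fix l assume l: "dual l"
    obtain M C where C: "0 \<le> C" "\<And>n m. n \<ge> M \<Longrightarrow> m \<ge> M \<Longrightarrow> a (l (z n) - l (z m)) \<le> (C * a (\<tau> n - \<tau> m)) powr \<sigma>"
      "\<And>n. n \<ge> M \<Longrightarrow> a (l (z n) - G l (X 0)) \<le> (C * a (\<tau> n)) powr \<sigma>"
      using local[OF l] by blast
    have "a (l (z n)) \<le> (C * a (\<tau> M)) powr \<sigma> + a (G l (X 0))" if n: "n \<ge> M" for n
    proof -
      have "a (l (z n) - G l (X 0)) \<le> (C * a (\<tau> n)) powr \<sigma>" using C(3)[OF n] .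
      also have "\<dots> \<le> (C * a (\<tau> M)) powr \<sigma>"
        using C(1) \<sigma> \<tau>_dec[OF n] by (intro powr_mono2 mult_left_mono) auto
      finally show ?thesis using a_add[of "l (z n) - G l (X 0)" "G l (X 0)"] by simp
    qed
    from eventually_bounded[where f = "\<lambda>n. a (l (z n))", OF this] obtain Z where Z: "\<And>n. a (l (z n)) \<le> Z" by blast
    \<comment> \<open>The default value 0 from \<open>M\<close> on makes
      \<open>eventually_bounded\<close> applicable; \<open>R\<close> then bounds the finitely many
      inverse sizes with index below \<open>M\<close>.\<close>
    have "\<exists>R. \<forall>i. (if i < M then inverse (a (d i)) else 0) \<le> R"
      by (rule eventually_bounded[of M _ 0]) simp
    then obtain R where R: "\<And>i. (if i < M then inverse (a (d i)) else 0) \<le> R" by blast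
    have R0: "0 \<le> R" using R[of M] by simp
    have Z0: "0 \<le> Z" using Z[of 0] a_nonneg[of "l (z 0)"] by linarith
    have "a (l (smF (inverse (d (min n m))) (z n - z m))) \<le> (C * 2) powr \<sigma> / kap + R * (2 * Z)" for n m
    proof -
      let ?i = "min n m"
      have eq: "a (l (smF (inverse (d ?i)) (z n - z m))) = inverse (a (d ?i)) * a (l (z n) - l (z m))"
        using d(1)[of ?i] by (simp only: dual_simps[OF l] a_mult a_inverse not_False_eq_True)
      have inv0: "0 \<le> inverse (a (d ?i))" by simp
      show ?thesis
      proof (cases "?i < M")
        case True
        then have 1: "inverse (a (d ?i)) \<le> R" using R[of ?i] by simp
        have 2: "a (l (z n) - l (z m)) \<le> 2 * Z"
          using a_add[of "l (z n)" "- l (z m)"] Z[of n] Z[of m] by simp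
        have "inverse (a (d ?i)) * a (l (z n) - l (z m)) \<le> R * (2 * Z)"
          using mult_mono[OF 1 2 R0 a_nonneg] .
        moreover have "0 \<le> (C * 2) powr \<sigma> / kap" using kap by simp
        ultimately show ?thesis unfolding eq by linarith
      next
        case False
        then have nm: "n \<ge> M" "m \<ge> M" by auto
        have "a (\<tau> n - \<tau> m) \<le> a (\<tau> n) + a (\<tau> m)" using a_add[of "\<tau> n" "- \<tau> m"] by simp
        also have "\<dots> \<le> 2 * a (\<tau> ?i)" using \<tau>_dec[of ?i n] \<tau>_dec[of ?i m] by simp
        finally have 1: "a (\<tau> n - \<tau> m) \<le> 2 * a (\<tau> ?i)" .
        have "a (l (z n) - l (z m)) \<le> (C * a (\<tau> n - \<tau> m)) powr \<sigma>" using C(2)[OF nm] .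
        also have "\<dots> \<le> (C * (2 * a (\<tau> ?i))) powr \<sigma>"
          using C(1) \<sigma> 1 by (intro powr_mono2 mult_left_mono) auto
        also have "\<dots> = (C * 2) powr \<sigma> * a (\<tau> ?i) powr \<sigma>"
          using C(1) powr_mult[of "C * 2" "a (\<tau> ?i)" \<sigma>] by (simp add: mult.assoc)
        also have "\<dots> \<le> (C * 2) powr \<sigma> * (a (d ?i) / kap)"
          using d(2)[of ?i] kap by (intro mult_left_mono) (auto simp: pos_le_divide_eq mult.commute)
        finally have "inverse (a (d ?i)) * a (l (z n) - l (z m)) \<le> inverse (a (d ?i)) * ((C * 2) powr \<sigma> * (a (d ?i) / kap))"
          using inv0 by (intro mult_left_mono)
        also have "\<dots> = (C * 2) powr \<sigma> / kap"
          using d(1)[of ?i] kap by (simp add: field_simps)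
        finally show ?thesis unfolding eq using mult_nonneg_nonneg[OF R0, of "2 * Z"] Z0 by linarith
      qed
    qed
    then show "\<exists>R. \<forall>x\<in>B. a (l x) \<le> R" unfolding B_def by blast
  qed
  have "bounded_set a smF TF B"
    unfolding bounded_set_def
  proof (intro allI impI)
    fix W assume "zero_nbhd TF W"
    then obtain e where e: "e > 0" "\<forall>t x. a t < e \<longrightarrow> x \<in> B \<longrightarrow> smF t x \<in> W"
      using Mackey[OF \<open>weakly_bounded a smF TF B\<close>] by blast
    have "zero_nbhd (ktop a) {t. a t < e}" unfolding zero_nbhd_ktop using e(1) by blast
    then show "\<exists>V. zero_nbhd (ktop a) V \<and> (\<forall>t\<in>V. \<forall>b\<in>B. smF t b \<in> W)" using e(2) by blast
  qed
  moreover have "z n - z m \<in> smF (d (min n m)) ` B" for n m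
    using F.sm_inverse(2)[OF d(1), of "min n m" "z n - z m"] unfolding B_def
    by (intro image_eqI[of _ _ "smF (inverse (d (min n m))) (z n - z m)"]) auto
  moreover have "\<exists>N. \<forall>n\<ge>N. \<forall>m\<ge>N. a (d (min n m)) < \<epsilon>" if \<epsilon>: "\<epsilon> > 0" for \<epsilon>
  proof -
    obtain N where N: "\<And>n. n \<ge> N \<Longrightarrow> a (\<tau> n) < \<epsilon> powr (1 / \<sigma>)" using \<tau>_lim[of "\<epsilon> powr (1 / \<sigma>)"] \<epsilon> by auto
    have "a (d i) < \<epsilon>" if "i \<ge> N" for i
    proof -
      have "a (d i) < a (\<tau> i) powr \<sigma>" using d(3) .
      also have "\<dots> \<le> (\<epsilon> powr (1 / \<sigma>)) powr \<sigma>" using N[OF that] \<sigma> by (intro powr_mono2) auto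
      also have "\<dots> = \<epsilon>" using \<sigma> \<epsilon> by (simp add: powr_powr)
      finally show ?thesis .
    qed
    then show ?thesis by (intro exI[of _ N]) simp
  qed
  ultimately have "mackey_cauchy a smF TF z"
    unfolding mackey_cauchy_def by (intro exI[of _ B] exI[of _ "\<lambda>n m. d (min n m)"]) simp
  then obtain v where v: "limitin TF z v sequentially" using complete unfolding mackey_complete_def by blast
  have "l v = G l (X 0)" if l: "dual l" for l
  proof -
    obtain M C where C: "0 \<le> C" "\<And>n. n \<ge> M \<Longrightarrow> a (l (z n) - G l (X 0)) \<le> (C * a (\<tau> n)) powr \<sigma>"
      using local[OF l] by blast
    have "continuous_map TF (ktop a) l" using l unfolding dual_def by blast
    then have "limitin (ktop a) (l \<circ> z) (l v) sequentially" using v by (rule continuous_map_limit)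
    then have lim: "\<exists>N. \<forall>n\<ge>N. a (l (z n) - l v) < e" if "e > 0" for e
      using that unfolding limitin_ktop by simp
    have "a (l v - G l (X 0)) \<le> 0 + e" if e: "e > 0" for e
    proof -
      obtain N1 where N1: "\<And>n. n \<ge> N1 \<Longrightarrow> a (l (z n) - l v) < e / 2" using lim[of "e / 2"] e by auto
      define e' where "e' = (e / 2) powr (1 / \<sigma>) / (C + 1)"
      have "e' > 0" unfolding e'_def using e C(1) by simp
      then obtain N2 where N2: "\<And>n. n \<ge> N2 \<Longrightarrow> a (\<tau> n) < e'" using \<tau>_lim by blast
      define n where "n = max M (max N1 N2)"
      have n: "n \<ge> M" "n \<ge> N1" "n \<ge> N2" unfolding n_def by auto
      have "C * a (\<tau> n) \<le> (C + 1) * e'" using N2[OF n(3)] C(1) by (intro mult_mono) auto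
      also have "\<dots> = (e / 2) powr (1 / \<sigma>)" unfolding e'_def using C(1) by simp
      finally have "(C * a (\<tau> n)) powr \<sigma> \<le> ((e / 2) powr (1 / \<sigma>)) powr \<sigma>"
        using \<sigma> C(1) by (intro powr_mono2) auto
      also have "\<dots> = e / 2" using \<sigma> e by (simp add: powr_powr)
      finally have "a (l (z n) - G l (X 0)) \<le> e / 2" using C(2)[OF n(1)] by linarith
      moreover have "a (l v - l (z n)) < e / 2" using N1[OF n(2)] by (simp add: a_diff_commute)
      ultimately show ?thesis using a_diff_triangle[of "l v" "G l (X 0)" "l (z n)"] by linarith
    qed
    then have "a (l v - G l (X 0)) \<le> 0" by (rule field_le_epsilon)
    then have "a (l v - G l (X 0)) = 0" using a_nonneg by (rule antisym)
    then show ?thesis by simp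
  qed
  then show ?thesis unfolding X_def by blast
qed

text \<open>The values of \<open>hs\<close> are fixed pointwise, as vectors at which each functional
  takes the value prescribed by its own family \<open>H l\<close>. Hoelder estimates for
  \<open>hs\<close> then follow from the weak ones, and continuity, including that at t = 0, follows
  from the Hoelder estimates.\<close>

lemma weakly_C_BGN_holder:
  assumes U: "openin TE U" and complete: "mackey_complete a smF TF"
    and weak: "\<And>l. dual l \<Longrightarrow> C_BGN_holder a smE TE (*) (ktop a) k \<sigma> U (l \<circ> f)"
  shows "C_BGN_holder a smE TE smF TF k \<sigma> U f"
proof -
  have "\<forall>l. \<exists>hs. dual l \<longrightarrow> bgn_seq a smE TE (*) (ktop a) k U (l \<circ> f) hs
      \<and> (\<forall>j. enat j \<le> k \<longrightarrow> holder0 a smE TE (*) (ktop a) \<sigma> j (pdom smE U j) (hs j))"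
    using weak unfolding C_BGN_holder_def by blast
  from choice[OF this] obtain H where H: "\<And>l. dual l \<Longrightarrow> bgn_seq a smE TE (*) (ktop a) k U (l \<circ> f) (H l)"
    "\<And>l j. dual l \<Longrightarrow> enat j \<le> k \<Longrightarrow> holder0 a smE TE (*) (ktop a) \<sigma> j (pdom smE U j) (H l j)"
    by blast
  have H0: "H l 0 (BLeaf x) = l (f x)" if "dual l" "x \<in> U" for l x
    using H(1)[OF that(1)] that(2) unfolding bgn_seq_def by simp
  have HS: "H l (Suc j) (BNode x y t) = inverse t * (H l j (padd x (psmul smE t y)) - H l j x)"
    if "dual l" "enat (Suc j) \<le> k" "BNode x y t \<in> pdom smE U (Suc j)" "t \<noteq> 0" for l j x y t
    using H(1)[OF that(1)] that(2-4) unfolding bgn_seq_def by blast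
  \<comment> \<open>Where such a vector exists, it is unique by \<open>dual_separates\<close>;
    existence is only claimed on the domains.\<close>
  define hs where "hs j x = (SOME v. \<forall>l. dual l \<longrightarrow> l v = H l j x)" for j x
  have hsI: "l (hs j x) = H l j x" if ex: "\<exists>v. \<forall>l. dual l \<longrightarrow> l v = H l j x" and l: "dual l" for j x l
    using someI_ex[OF ex] l unfolding hs_def by blast
  have pred: "enat j \<le> k" if "enat (Suc j) \<le> k" for j
    using that by (rule order_trans[rotated]) simp
  \<comment> \<open>If the last entry of a tree is nonzero, the difference quotient of the vectors
    one level lower has the required values; if it is 0, \<open>extension_at_zero\<close> provides
    the vector.\<close>
  have ex: "\<exists>v. \<forall>l. dual l \<longrightarrow> l v = H l j x" if "enat j \<le> k" "x \<in> pdom smE U j" for j x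
    using that
  proof (induction j arbitrary: x)
    case 0
    then obtain u where "x = BLeaf u" "u \<in> U" by auto
    then show ?case using H0 by (intro exI[of _ "f u"]) simp
  next
    case (Suc j)
    obtain u v t where x: "x = BNode u v t" "u \<in> pdom smE U j" "v \<in> lev j"
      "padd u (psmul smE t v) \<in> pdom smE U j" using Suc.prems(2) by auto
    note IH = Suc.IH[OF pred[OF Suc.prems(1)]]
    define g where "g s = smF (inverse s) (hs j (padd u (psmul smE s v)) - hs j u)" for s
    have g: "l (g s) = H l (Suc j) (BNode u v s)"
      if "dual l" "s \<noteq> 0" "BNode u v s \<in> pdom smE U (Suc j)" for l s
    proof -
      have "padd u (psmul smE s v) \<in> pdom smE U j" using that(3) by auto
      then show ?thesis
        using HS[OF that(1) Suc.prems(1) that(3,2)] hsI[OF IH that(1)] x(2)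
        unfolding g_def by (simp add: dual_simps[OF that(1)])
    qed
    show ?case
    proof (cases "t = 0")
      case True
      show ?thesis unfolding x(1) True
      proof (rule extension_at_zero[OF U complete x(2,3)])
        show "\<And>l s. dual l \<Longrightarrow> s \<noteq> 0 \<Longrightarrow> BNode u v s \<in> pdom smE U (Suc j) \<Longrightarrow>
            l (g s) = H l (Suc j) (BNode u v s)" by (rule g)
        show "\<And>l. dual l \<Longrightarrow> holder0 a smE TE (*) (ktop a) \<sigma> (Suc j) (pdom smE U (Suc j)) (H l (Suc j))"
          using H(2) Suc.prems(1) by blast
      qed
    next
      case False
      then show ?thesis using g Suc.prems(2) unfolding x(1) by blast
    qed
  qed
  have hs: "l (hs j x) = H l j x" if "dual l" "enat j \<le> k" "x \<in> pdom smE U j" for l j x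
    using hsI[OF ex[OF that(2,3)] that(1)] .
  have holder: "holder0 a smE TE smF TF \<sigma> j (pdom smE U j) (hs j)" if j: "enat j \<le> k" for j
  proof (rule weakly_holder_imp_holder[OF _ pdom_subset_lev])
    fix l assume l: "dual l"
    have eq: "\<And>x. x \<in> pdom smE U j \<Longrightarrow> l (hs j x) = H l j x" using hs[OF l j] .
    show "holder0 a smE TE (*) (ktop a) \<sigma> j (pdom smE U j) (\<lambda>x. l (hs j x))"
      by (rule holder0_cong[OF H(2)[OF l j]]) (simp add: eq)
  qed
  have "bgn_seq a smE TE smF TF k U f hs"
    unfolding bgn_seq_def
  proof (intro conjI ballI allI impI)
    fix x assume x: "x \<in> U"
    have "enat 0 \<le> k" by (simp add: zero_enat_def[symmetric])
    then show "hs 0 (BLeaf x) = f x"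
      using hs[of _ 0 "BLeaf x"] x H0 by (intro dual_separates) auto
  next
    fix j assume "enat j \<le> k"
    then show "continuous_map (subtopology (ptop a TE j) (pdom smE U j)) TF (hs j)"
      by (rule holder_continuous[OF holder pdom_subset_lev])
  next
    fix j x y t assume j: "enat (Suc j) \<le> k" and xyt: "BNode x y t \<in> pdom smE U (Suc j) \<and> t \<noteq> 0"
    then have "x \<in> pdom smE U j" "padd x (psmul smE t y) \<in> pdom smE U j" by auto
    then have "l (hs (Suc j) (BNode x y t)) = l (smF (inverse t) (hs j (padd x (psmul smE t y)) - hs j x))"
      if l: "dual l" for l
      using hs[OF l j] hs[OF l pred[OF j]] xyt HS[OF l j]
      by (simp add: dual_simps[OF l] del: pdom.simps)
    then show "hs (Suc j) (BNode x y t) = smF (inverse t) (hs j (padd x (psmul smE t y)) - hs j x)"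
      by (rule dual_separates)
  qed
  then show ?thesis unfolding C_BGN_holder_def using holder by blast
qed

end

text \<open>A gauge \<open>q\<close> on the scalars pulls back along \<open>l\<close> to a gauge on
  the target space, so each Hoelder estimate transfers with the same gauge and neighbourhood in the
  source.\<close>

lemma C_BGN_holder_compose:
  assumes l: "lin_functional sm l" "continuous_map T (ktop a) l" and tvs: "tvs a sm T"
    and f: "C_BGN_holder a smE TE sm T k \<sigma> U f"
  shows "C_BGN_holder a smE TE (*) (ktop a) k \<sigma> U (l \<circ> f)"
proof -
  have add: "l (x + y) = l x + l y" and scale: "l (sm t x) = t * l x" for x y t
    using l(1) unfolding lin_functional_def by auto
  have diff: "l (x - y) = l x - l y" for x y using add[of "x - y" y] by simp
  have l0: "l 0 = 0" using diff[of 0 0] by simp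
  obtain hs where hs: "bgn_seq a smE TE sm T k U f hs"
    "\<And>j. enat j \<le> k \<Longrightarrow> holder0 a smE TE sm T \<sigma> j (pdom smE U j) (hs j)"
    using f unfolding C_BGN_holder_def by blast
  have "bgn_seq a smE TE (*) (ktop a) k U (l \<circ> f) (\<lambda>j. l \<circ> hs j)"
    unfolding bgn_seq_def
  proof (intro conjI allI impI ballI)
    fix j assume "enat j \<le> k"
    then show "continuous_map (subtopology (ptop a TE j) (pdom smE U j)) (ktop a) (l \<circ> hs j)"
      using hs(1) continuous_map_compose[OF _ l(2)] unfolding bgn_seq_def by blast
  qed (use hs(1) in \<open>simp_all add: bgn_seq_def scale diff del: pdom.simps ptop.simps\<close>)
  moreover have "holder0 a smE TE (*) (ktop a) \<sigma> j (pdom smE U j) (l \<circ> hs j)" if j: "enat j \<le> k" for j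
    unfolding holder0_def
  proof (intro ballI allI impI)
    fix x0 q assume x0: "x0 \<in> pdom smE U j" and q: "gauge a (*) (ktop a) q"
    have "zero_nbhd T {x. q (l x) < r}" if "r > 0" for r
    proof -
      obtain S where S: "openin (ktop a) S" "0 \<in> S" "S \<subseteq> {x. q x < r}"
        using q \<open>r > 0\<close> unfolding gauge_def zero_nbhd_def by blast
      have "openin T {x \<in> topspace T. l x \<in> S}" using openin_continuous_map_preimage[OF l(2) S(1)] .
      moreover have "topspace T = UNIV" using tvs unfolding tvs_def by blast
      ultimately show ?thesis unfolding zero_nbhd_def
        using S l0 by (intro exI[of _ "{x \<in> topspace T. l x \<in> S}"]) auto
    qed
    then have ql: "gauge a sm T (q \<circ> l)" using q unfolding gauge_def by (simp add: scale)
    show "\<exists>p W. pgauge a smE TE j p \<and> W \<subseteq> pdom smE U j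
        \<and> (\<exists>Ov. openin (ptop a TE j) Ov \<and> x0 \<in> Ov \<and> Ov \<inter> pdom smE U j \<subseteq> W)
        \<and> (\<forall>x\<in>W. \<forall>y\<in>W. q ((l \<circ> hs j) y - (l \<circ> hs j) x) \<le> p (psub y x) powr \<sigma>)"
      using hs(2)[OF j, unfolded holder0_def, rule_format, OF x0 ql] by (simp add: diff)
  qed
  ultimately show ?thesis unfolding C_BGN_holder_def by blast
qed

theorem theorem5p6:
  fixes a :: "'k::field \<Rightarrow> real"
    and smE :: "'k \<Rightarrow> 'e::ab_group_add \<Rightarrow> 'e" and TE :: "'e topology"
    and smF :: "'k \<Rightarrow> 'f::ab_group_add \<Rightarrow> 'f" and TF :: "'f topology"
    and f :: "'e \<Rightarrow> 'f" and U :: "'e set" and k :: enat and \<sigma> :: real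
  assumes "locally_compact_field a"
    and "is_real_field a \<or> totally_disconnected_top (ktop a)"
    and "tvs a smE TE" and "tvs a smF TF"
    and "openin TE U"
    and "0 < \<sigma>" and "\<sigma> \<le> 1"
    and "metrizable_space TE"
    and "mackey_complete a smF TF" and "locally_convex a smF TF"
  shows "C_BGN_holder a smE TE smF TF k \<sigma> U f \<longleftrightarrow>
    (\<forall>l. lin_functional smF l \<and> continuous_map TF (ktop a) l \<longrightarrow>
         C_BGN_holder a smE TE (*) (ktop a) k \<sigma> U (l \<circ> f))"
proof (intro iffI allI impI)
  fix l assume "C_BGN_holder a smE TE smF TF k \<sigma> U f" "lin_functional smF l \<and> continuous_map TF (ktop a) l"
  then show "C_BGN_holder a smE TE (*) (ktop a) k \<sigma> U (l \<circ> f)"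
    using C_BGN_holder_compose[OF _ _ assms(4)] by blast
next
  assume weak: "\<forall>l. lin_functional smF l \<and> continuous_map TF (ktop a) l \<longrightarrow>
    C_BGN_holder a smE TE (*) (ktop a) k \<sigma> U (l \<circ> f)"
  have abs: "absval a" using locally_compact_field_absval[OF assms(1)] .
  have E: "absval_tvs a smE TE" and F: "absval_tvs a smF TF"
    using abs assms(3,4) by (simp_all add: absval_tvs_def absval_tvs_axioms_def)
  obtain p :: "nat \<Rightarrow> 'e \<Rightarrow> real" where p: "\<And>n. gauge a smE TE (p n)" "\<And>m n x. m \<le> n \<Longrightarrow> p m x \<le> p n x"
    "\<And>W. zero_nbhd TE W \<Longrightarrow> \<exists>n. {x. p n x < 1} \<subseteq> W"
    by (rule absval_tvs.metrizable_gauges[OF E assms(8)]) blast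
  have Mackey: "\<exists>\<delta>>0. \<forall>t x. a t < \<delta> \<longrightarrow> x \<in> B \<longrightarrow> smF t x \<in> W"
    if B: "weakly_bounded a smF TF B" and W: "zero_nbhd TF W" for B W
    by (rule weakly_bounded_imp_bounded[OF assms(1,2,4,10) B W]) blast
  interpret weak_setting a smE TE p smF TF \<sigma>
    using E F p Mackey assms(6)
    by (simp add: weak_setting_def weak_setting_axioms_def gauge_base_def gauge_base_axioms_def)
  show "C_BGN_holder a smE TE smF TF k \<sigma> U f"
    using weak by (intro weakly_C_BGN_holder[OF assms(5,9)]) (simp add: dual_def)
qed

end
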